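(* Let $M$ be a QTM, $|\phi\rangle\in\ell^2_1(\mathfrak{C}^{init}_M)$ an initial q-configuration with computation $|\phi_k\rangle=U_M^k|\phi\rangle$ ($k\in\mathbb{N}$), and $\tau:\mathbb{N}\to\mathbb{N}$ strictly increasing. For every $n\in\mathbb{N}$: (1) for every $i\in\mathbb{N}$ and $k=\tau(i)+1$, $P_{|\phi_k\rangle}(n)=\Pr\{R\in\mathcal{K}[k]\mid R\text{ has observed output }n\}$; (2) $\lim_{k\to\infty}P_{|\phi_k\rangle}(n)=\Pr\{R\in\mathcal{K}\mid R\text{ has observed output }n\}$.
   Context: A pre-QTM is a tuple $M=\langle\Sigma,Q,Q_s,Q_t,\delta_0,q_i,q_f\rangle$ with finite tape alphabet $\Sigma\ni 1,\Box$, finite set of states $Q$, source states $Q_s\subseteq Q$ containing the initial state $q_i$, target states $Q_t\subseteq Q$ containing the final state $q_f$, and $\delta_0:(Q\setminus Q_t)\times\Sigma\to\ell^2((Q\setminus Q_s)\times\Sigma\times\{L,R\})$. A configuration is $\langle\alpha,q,\beta,n\rangle\in\Sigma^*\times Q\times\Sigma^*\times\mathbb{N}$ ($\alpha$ the tape to the left of the head, $\beta$ the tape from the head cell on, the head reading the first symbol of $\beta$ or $\Box$ if $\beta$ is empty; $n$ a counter), identified up to adding blanks left of $\alpha$ and right of $\beta$, with $n=0$ whenever $q\notin Q_s\cup Q_t$. $\mathfrak{C}_M$ is the set of configurations, $\mathfrak{C}^{init}_M$ / $\mathfrak{C}^{fin}_M$ those with state $q_i$ / $q_f$. For $C=\langle\alpha,q,u\beta,0\rangle$,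 let $C_{p,v,R}=\langle\alpha v,p,\beta,0\rangle$ and, writing $\alpha=\alpha'w$ ($w=\Box$ if $\alpha$ is empty), $C_{p,v,L}=\langle\alpha',p,wv\beta,0\rangle$. The time evolution operator $U_M$ on $\ell^2(\mathfrak{C}_M)$ is the continuous linear extension of: (i) for $C=\langle\alpha,q,u\beta,0\rangle$ with $q\notin Q_t$: $U_M|C\rangle=\sum_{(p,v,d)\in(Q\setminus Q_s)\times\Sigma\times\{L,R\}}\delta_0(q,u)(p,v,d)|C_{p,v,d}\rangle$; (ii) for $q\in Q_s$, $n>0$: $U_M|\langle\alpha,q,\beta,n\rangle\rangle=|\langle\alpha,q,\beta,n-1\rangle\rangle$; (iii) for $q\in Q_t$: $U_M|\langle\alpha,q,\beta,n\rangle\rangle=|\langle\alpha,q,\beta,n+1\rangle\rangle$. $M$ is a QTM if $U_M$ is unitary. $\ell^2_1(B)$ denotes unit vectors of $\ell^2(B)$ (q-configurations). For $C=\langle\alpha,q,\beta,n\rangle$, $\mathrm{val}[C]$ is the number of $1$'s in $\alpha\beta$; for $|\psi\rangle=\sum_Ce_C|C\rangle$, $P_{|\psi\rangle}(n)=\sum_{C\in\mathfrak{C}^{fin}_M,\mathrm{val}[C]=n}|e_C|^2$. Output observation: for a q-configuration $|\psi\rangle=\sum_{C}e_C|C\rangle$, an output observation of $|\psi\rangle$ with observed output $x\in\mathbb{N}\cup\{\bot\}$ and collapsed q-configuration $|\psi'\rangle$ is either (a) $x=n\in\mathbb{N}$ and $|\psi'\rangle=(e_C/|e_C|)|C\rangle$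 for some $C\in\mathfrak{C}^{fin}_M$ with $\mathrm{val}[C]=n$ and $e_C\neq0$, with probability $|e_C|^2$; or (b) $x=\bot$ and $|\psi'\rangle=|\psi_{nf}\rangle/\|\psi_{nf}\|$ where $|\psi_{nf}\rangle=\sum_{C\notin\mathfrak{C}^{fin}_M}e_C|C\rangle\neq0$, with probability $\|\psi_{nf}\|^2$. $\tau$-observed runs: a $\tau$-observed run of $M$ on $|\phi\rangle$ is a sequence $R=\{|\phi_h\rangle\}_{h\in\mathbb{N}}$ (not to be confused with the computation) with $|\phi_0\rangle=|\phi\rangle$; if $h=\tau(i)$ for some $i$, then $|\phi_{h+1}\rangle$ is the collapsed q-configuration of some output observation of $U_M|\phi_h\rangle$, whose observed output is denoted $x_i$; otherwise $|\phi_{h+1}\rangle=U_M|\phi_h\rangle$. The observed output of $R$ is $n\in\mathbb{N}$ if $x_i=n$ for some $i$, and $\bot$ otherwise. A finite $\tau$-observed run of length $k$, $R[k]$, is the prefix $(|\phi_0\rangle,\dots,|\phi_k\rangle)$ of some $\tau$-observed run; for $k=\tau(i)+1$ its observed output is $x_i$. Probabilities: $\Pr(R[0])=1$; $\Pr(R[h+1])=\Pr(R[h])\cdot p_h$ where $p_h$ is the probability of the output observation of $U_M|\phi_h\rangle$ producing $|\phi_{h+1}\rangle$ if $h=\tau(i)$ for some $i$, and $p_h=1$ otherwise; $\Pr(R)=\lim_{k\to\infty}\Pr(R[k])$. $\mathcal{K}$ is the set of all $\tau$-observed runs of $M$ on $|\phi\rangle$ and $\mathcal{K}[k]$ the set of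 finite ones of length $k$; for a subset $B$ of either, $\Pr B=\sum_{R\in B}\Pr(R)$. *)

theory Defs
  imports "HOL-Analysis.Analysis"
begin

section \<open>Hilbert spaces of square-summable families\<close>

text \<open>The space of square-summable complex families indexed by a set \<open>B\<close> is a set of functions
  on the ambient type that vanish outside \<open>B\<close>; so \<open>ell2 A \<subseteq> ell2 B\<close> whenever \<open>A \<subseteq> B\<close>.\<close>

definition ell2 :: "'c set \<Rightarrow> ('c \<Rightarrow> complex) set" where
  "ell2 B = {f. (\<forall>x. x \<notin> B \<longrightarrow> f x = 0) \<and> (\<lambda>x. (cmod (f x))\<^sup>2) summable_on B}"

definition ell2_norm :: "('c \<Rightarrow> complex) \<Rightarrow> real" where
  "ell2_norm f = sqrt (\<Sum>\<^sub>\<infinity>x. (cmod (f x))\<^sup>2)"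

definition ell2_inner :: "('c \<Rightarrow> complex) \<Rightarrow> ('c \<Rightarrow> complex) \<Rightarrow> complex" where
  "ell2_inner f g = (\<Sum>\<^sub>\<infinity>x. cnj (f x) * g x)"

definition unit_ell2 :: "'c set \<Rightarrow> ('c \<Rightarrow> complex) set" where
  "unit_ell2 B = {f \<in> ell2 B. ell2_norm f = 1}"

definition ket :: "'c \<Rightarrow> 'c \<Rightarrow> complex" where
  "ket C = (\<lambda>D. if D = C then 1 else 0)"

text \<open>Operators are extensional functions, so that an operator is determined by its values on
  the space.\<close>

definition bounded_operator :: "'c set \<Rightarrow> (('c \<Rightarrow> complex) \<Rightarrow> ('c \<Rightarrow> complex)) \<Rightarrow> bool" where
  "bounded_operator B U \<longleftrightarrow>
     U \<in> ell2 B \<rightarrow>\<^sub>E ell2 B \<and>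
     (\<forall>f\<in>ell2 B. \<forall>g\<in>ell2 B. U (\<lambda>x. f x + g x) = (\<lambda>x. U f x + U g x)) \<and>
     (\<forall>a. \<forall>f\<in>ell2 B. U (\<lambda>x. a * f x) = (\<lambda>x. a * U f x)) \<and>
     (\<exists>K. \<forall>f\<in>ell2 B. ell2_norm (U f) \<le> K * ell2_norm f)"

definition unitary_operator :: "'c set \<Rightarrow> (('c \<Rightarrow> complex) \<Rightarrow> ('c \<Rightarrow> complex)) \<Rightarrow> bool" where
  "unitary_operator B U \<longleftrightarrow>
     bounded_operator B U \<and>
     (\<exists>V. bounded_operator B V \<and>
          (\<forall>f\<in>ell2 B. \<forall>g\<in>ell2 B. ell2_inner (U f) g = ell2_inner f (V g)) \<and>
          (\<forall>f\<in>ell2 B. V (U f) = f \<and> U (V f) = f))"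


section \<open>Quantum Turing machines\<close>

datatype direction = Dir_L | Dir_R

record ('a, 's) machine =
  alphabet :: "'a set"
  one :: 'a
  blank :: 'a
  states :: "'s set"
  sources :: "'s set"
  targets :: "'s set"
  delta :: "'s \<times> 'a \<Rightarrow> 's \<times> 'a \<times> direction \<Rightarrow> complex"
  init_state :: 's
  final_state :: 's

definition moves :: "('a, 's) machine \<Rightarrow> ('s \<times> 'a \<times> direction) set" where
  "moves M = (states M - sources M) \<times> alphabet M \<times> {Dir_L, Dir_R}"

definition pre_qtm :: "('a, 's) machine \<Rightarrow> bool" where
  "pre_qtm M \<longleftrightarrow>
     finite (alphabet M) \<and> one M \<in> alphabet M \<and> blank M \<in> alphabet M \<and> one M \<noteq> blank M \<and>
     finite (states M) \<and>
     sources M \<subseteq> states M \<and> init_state M \<in> sources M \<and>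
     targets M \<subseteq> states M \<and> final_state M \<in> targets M \<and>
     (\<forall>x \<in> (states M - targets M) \<times> alphabet M. delta M x \<in> ell2 (moves M))"


subsection \<open>Configurations\<close>

type_synonym ('a, 's) raw_config = "'a list \<times> 's \<times> 'a list \<times> nat"

type_synonym ('a, 's) config = "('a, 's) raw_config set"

type_synonym ('a, 's) qconfig = "('a, 's) config \<Rightarrow> complex"

definition raw_configs :: "('a, 's) machine \<Rightarrow> ('a, 's) raw_config set" where
  "raw_configs M =
     {(\<alpha>, q, \<beta>, n). \<alpha> \<in> lists (alphabet M) \<and> q \<in> states M \<and> \<beta> \<in> lists (alphabet M) \<and>
                   (q \<notin> sources M \<union> targets M \<longrightarrow> n = 0)}"

definition config_rel ::
  "('a, 's) machine \<Rightarrow> (('a, 's) raw_config \<times> ('a, 's) raw_config) set" where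
  "config_rel M =
     {((\<alpha>, q, \<beta>, n), (\<alpha>', q', \<beta>', n')).
        (\<alpha>, q, \<beta>, n) \<in> raw_configs M \<and> (\<alpha>', q', \<beta>', n') \<in> raw_configs M \<and> q = q' \<and> n = n' \<and>
        (\<exists>j k. replicate j (blank M) @ \<alpha> = replicate k (blank M) @ \<alpha>') \<and>
        (\<exists>j k. \<beta> @ replicate j (blank M) = \<beta>' @ replicate k (blank M))}"

definition config_of :: "('a, 's) machine \<Rightarrow> ('a, 's) raw_config \<Rightarrow> ('a, 's) config" where
  "config_of M c = config_rel M `` {c}"

definition configs :: "('a, 's) machine \<Rightarrow> ('a, 's) config set" where
  "configs M = raw_configs M // config_rel M"

definition configs_in_state :: "('a, 's) machine \<Rightarrow> 's \<Rightarrow> ('a, 's) config set" where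
  "configs_in_state M q =
     {C. \<exists>\<alpha> \<beta> n. (\<alpha>, q, \<beta>, n) \<in> raw_configs M \<and> C = config_of M (\<alpha>, q, \<beta>, n)}"

definition init_configs :: "('a, 's) machine \<Rightarrow> ('a, 's) config set" where
  "init_configs M = configs_in_state M (init_state M)"

definition final_configs :: "('a, 's) machine \<Rightarrow> ('a, 's) config set" where
  "final_configs M = configs_in_state M (final_state M)"

text \<open>Since \<open>one M \<noteq> blank M\<close>, the number of ones does not depend on the representative.\<close>

definition config_val :: "('a, 's) machine \<Rightarrow> ('a, 's) config \<Rightarrow> nat" where
  "config_val M C = (THE m. \<exists>\<alpha> q \<beta> n. (\<alpha>, q, \<beta>, n) \<in> C \<and> m = count_list (\<alpha> @ \<beta>) (one M))"


subsection \<open>Time evolution\<close>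

text \<open>\<open>moved M \<alpha> \<beta> (p, v, d)\<close> is the configuration reached from the one with left tape \<open>\<alpha>\<close> and
  right tape \<open>u # \<beta>\<close> by overwriting \<open>u\<close> with \<open>v\<close>, entering state \<open>p\<close> and moving in direction \<open>d\<close>.\<close>

fun moved :: "('a, 's) machine \<Rightarrow> 'a list \<Rightarrow> 'a list \<Rightarrow> 's \<times> 'a \<times> direction \<Rightarrow> ('a, 's) config" where
  "moved M \<alpha> \<beta> (p, v, Dir_R) = config_of M (\<alpha> @ [v], p, \<beta>, 0)"
| "moved M \<alpha> \<beta> (p, v, Dir_L) =
     config_of M (butlast \<alpha>, p, (if \<alpha> = [] then blank M else last \<alpha>) # v # \<beta>, 0)"

definition is_time_evolution ::
  "('a, 's) machine \<Rightarrow> (('a, 's) qconfig \<Rightarrow> ('a, 's) qconfig) \<Rightarrow> bool" where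
  "is_time_evolution M U \<longleftrightarrow>
     bounded_operator (configs M) U \<and>
     (\<forall>\<alpha>\<in>lists (alphabet M). \<forall>\<beta>\<in>lists (alphabet M).
        (\<forall>q \<in> states M - targets M. \<forall>u \<in> alphabet M.
           U (ket (config_of M (\<alpha>, q, u # \<beta>, 0))) =
             (\<lambda>D. \<Sum>m\<in>moves M. delta M (q, u) m * ket (moved M \<alpha> \<beta> m) D)) \<and>
        (\<forall>q \<in> sources M. \<forall>n>0.
           U (ket (config_of M (\<alpha>, q, \<beta>, n))) = ket (config_of M (\<alpha>, q, \<beta>, n - 1))) \<and>
        (\<forall>q \<in> targets M. \<forall>n.
           U (ket (config_of M (\<alpha>, q, \<beta>, n))) = ket (config_of M (\<alpha>, q, \<beta>, n + 1))))"

text \<open>There is at most one time evolution, because the kets span a dense subspace; there is none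
  if some state is both a source and a target, because the equations then contradict each other.\<close>

definition evolution ::
  "('a, 's) machine \<Rightarrow> ('a, 's) qconfig \<Rightarrow> ('a, 's) qconfig" where
  "evolution M = (THE U. is_time_evolution M U)"

definition qtm :: "('a, 's) machine \<Rightarrow> bool" where
  "qtm M \<longleftrightarrow> pre_qtm M \<and> (\<exists>U. is_time_evolution M U) \<and> unitary_operator (configs M) (evolution M)"

definition value_prob :: "('a, 's) machine \<Rightarrow> ('a, 's) qconfig \<Rightarrow> nat \<Rightarrow> real" where
  "value_prob M \<psi> n = (\<Sum>\<^sub>\<infinity>C\<in>{C \<in> final_configs M. config_val M C = n}. (cmod (\<psi> C))\<^sup>2)"


section \<open>Observed runs\<close>

definition nonfinal_part :: "('a, 's) machine \<Rightarrow> ('a, 's) qconfig \<Rightarrow> ('a, 's) qconfig" where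
  "nonfinal_part M \<psi> = (\<lambda>C. if C \<in> final_configs M then 0 else \<psi> C)"

text \<open>\<open>output_observation M \<psi> x \<psi>' p\<close>: there is an output observation of \<open>\<psi>\<close> with observed output
  \<open>x\<close> (\<open>None\<close> encodes \<open>\<bottom>\<close>), collapsed q-configuration \<open>\<psi>'\<close> and probability \<open>p\<close>.\<close>

inductive output_observation ::
  "('a, 's) machine \<Rightarrow> ('a, 's) qconfig \<Rightarrow> nat option \<Rightarrow> ('a, 's) qconfig \<Rightarrow> real \<Rightarrow> bool"
  for M \<psi> where
  final: "\<lbrakk>C \<in> final_configs M; config_val M C = n; \<psi> C \<noteq> 0\<rbrakk> \<Longrightarrow>
    output_observation M \<psi> (Some n)
      (\<lambda>D. \<psi> C / complex_of_real (cmod (\<psi> C)) * ket C D) ((cmod (\<psi> C))\<^sup>2)"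
| nonfinal: "nonfinal_part M \<psi> \<noteq> (\<lambda>_. 0) \<Longrightarrow>
    output_observation M \<psi> None
      (\<lambda>D. nonfinal_part M \<psi> D / complex_of_real (ell2_norm (nonfinal_part M \<psi>)))
      ((ell2_norm (nonfinal_part M \<psi>))\<^sup>2)"

definition observed_runs ::
  "('a, 's) machine \<Rightarrow> (nat \<Rightarrow> nat) \<Rightarrow> ('a, 's) qconfig \<Rightarrow> (nat \<Rightarrow> ('a, 's) qconfig) set" where
  "observed_runs M \<tau> \<phi> =
     {R. R 0 = \<phi> \<and>
         (\<forall>h. if h \<in> range \<tau>
              then \<exists>x p. output_observation M (evolution M (R h)) x (R (Suc h)) p
              else R (Suc h) = evolution M (R h))}"

text \<open>A finite run of length \<open>k\<close> is a list of \<open>k + 1\<close> q-configurations.\<close>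

definition run_prefix :: "(nat \<Rightarrow> ('a, 's) qconfig) \<Rightarrow> nat \<Rightarrow> ('a, 's) qconfig list" where
  "run_prefix R k = map R [0..<Suc k]"

definition finite_observed_runs ::
  "('a, 's) machine \<Rightarrow> (nat \<Rightarrow> nat) \<Rightarrow> ('a, 's) qconfig \<Rightarrow> nat \<Rightarrow> ('a, 's) qconfig list set" where
  "finite_observed_runs M \<tau> \<phi> k = (\<lambda>R. run_prefix R k) ` observed_runs M \<tau> \<phi>"

text \<open>The collapsed q-configuration determines which output observation produced it, so the two
  descriptions below are unique along a run.\<close>

definition observed_output_at ::
  "('a, 's) machine \<Rightarrow> (nat \<Rightarrow> nat) \<Rightarrow> (nat \<Rightarrow> ('a, 's) qconfig) \<Rightarrow> nat \<Rightarrow> nat option" where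
  "observed_output_at M \<tau> R i =
     (THE x. \<exists>p. output_observation M (evolution M (R (\<tau> i))) x (R (Suc (\<tau> i))) p)"

definition observation_prob ::
  "('a, 's) machine \<Rightarrow> ('a, 's) qconfig \<Rightarrow> ('a, 's) qconfig \<Rightarrow> real" where
  "observation_prob M \<psi> \<psi>' = (THE p. \<exists>x. output_observation M \<psi> x \<psi>' p)"

definition finite_run_output ::
  "('a, 's) machine \<Rightarrow> (nat \<Rightarrow> nat) \<Rightarrow> nat \<Rightarrow> ('a, 's) qconfig list \<Rightarrow> nat option" where
  "finite_run_output M \<tau> i rs = observed_output_at M \<tau> ((!) rs) i"

definition run_has_output ::
  "('a, 's) machine \<Rightarrow> (nat \<Rightarrow> nat) \<Rightarrow> (nat \<Rightarrow> ('a, 's) qconfig) \<Rightarrow> nat option \<Rightarrow> bool" where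
  "run_has_output M \<tau> R x \<longleftrightarrow>
     (case x of
        Some n \<Rightarrow> \<exists>i. observed_output_at M \<tau> R i = Some n
      | None \<Rightarrow> \<forall>i. observed_output_at M \<tau> R i = None)"

definition finite_run_prob ::
  "('a, 's) machine \<Rightarrow> (nat \<Rightarrow> nat) \<Rightarrow> ('a, 's) qconfig list \<Rightarrow> real" where
  "finite_run_prob M \<tau> rs =
     (\<Prod>h<length rs - 1.
        if h \<in> range \<tau> then observation_prob M (evolution M (rs ! h)) (rs ! Suc h) else 1)"

definition run_prob ::
  "('a, 's) machine \<Rightarrow> (nat \<Rightarrow> nat) \<Rightarrow> (nat \<Rightarrow> ('a, 's) qconfig) \<Rightarrow> real" where
  "run_prob M \<tau> R = lim (\<lambda>k. finite_run_prob M \<tau> (run_prefix R k))"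

end

theory Submission
  imports Defs
begin

text \<open>Unitarity turns \<open>U |C\<rangle> = |advance C\<rangle>\<close> for final \<open>C\<close> into \<open>(U \<psi>) (advance C) = \<psi> C\<close>: the amplitude of
  an advanced final configuration comes from its predecessor only, so amplitude enters the final
  configurations only with counter \<open>0\<close> and then just travels along the counter without
  interfering with later arrivals. Hence projecting the final part away by an observation changes
  neither the nonfinal amplitudes nor the amplitudes of the later arrivals. A run with an observed
  value is therefore determined by the arrival \<open>(h, D)\<close> (entry time and entry configuration) that the
  next observation finds; in the product of its probabilities the normalizations cancel, leaving
  \<open>\<bar>\<phi>\<^sub>h\<^sub>+\<^sub>1(D)\<bar>\<^sup>2\<close>. The probability \<open>P(n)\<close> at time \<open>k\<close> is the sum of the same weights over the arrivals
  with \<open>h < k\<close> and value \<open>n\<close>, and letting \<open>k\<close> tend to infinity exhausts all arrivals.\<close>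

section \<open>Square-summable families\<close>

text \<open>Terms outside \<open>B\<close> vanish, so summability can be tested over the whole type;
  later norms and inner products then do not depend on \<open>B\<close>.\<close>

lemma ell2_iff:
  "f \<in> ell2 B \<longleftrightarrow> (\<forall>x. x \<notin> B \<longrightarrow> f x = 0) \<and> (\<lambda>x. (cmod (f x))\<^sup>2) summable_on UNIV"
proof -
  have "(\<lambda>x. (cmod (f x))\<^sup>2) summable_on B \<longleftrightarrow> (\<lambda>x. (cmod (f x))\<^sup>2) summable_on UNIV"
    if "\<forall>x. x \<notin> B \<longrightarrow> f x = 0"
    by (rule summable_on_cong_neutral) (use that in auto)
  then show ?thesis unfolding ell2_def by blast
qed

lemma ell2_mono: "A \<subseteq> B \<Longrightarrow> ell2 A \<subseteq> ell2 B"
  unfolding ell2_iff subset_iff by blast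

lemma ell2_outside: "f \<in> ell2 B \<Longrightarrow> x \<notin> B \<Longrightarrow> f x = 0"
  by (simp add: ell2_def)

lemma ell2_summable: "f \<in> ell2 B \<Longrightarrow> (\<lambda>x. (cmod (f x))\<^sup>2) summable_on A"
  by (rule summable_on_subset_banach[of _ UNIV]) (auto simp: ell2_iff)

lemma ell2_scale: "f \<in> ell2 B \<Longrightarrow> (\<lambda>x. a * f x) \<in> ell2 B"
  unfolding ell2_iff by (auto simp: norm_mult power_mult_distrib intro: summable_on_cmult_right)

lemma ell2_dominated:
  assumes "f \<in> ell2 B" "\<And>x. cmod (g x) \<le> cmod (f x)"
  shows "g \<in> ell2 B"
proof -
  have "(\<lambda>x. (cmod (g x))\<^sup>2) summable_on UNIV"
    by (rule summable_on_comparison_test[where f = "\<lambda>x. (cmod (f x))\<^sup>2"])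
      (use assms in \<open>auto intro: power_mono ell2_summable[OF assms(1)]\<close>)
  moreover have "g x = 0" if "x \<notin> B" for x
    using ell2_outside[OF assms(1) that] assms(2)[of x] by simp
  ultimately show ?thesis by (auto simp: ell2_iff)
qed

lemma ell2_add:
  assumes "f \<in> ell2 B" "g \<in> ell2 B"
  shows "(\<lambda>x. f x + g x) \<in> ell2 B"
proof -
  have "(cmod (f x + g x))\<^sup>2 \<le> 2 * (cmod (f x))\<^sup>2 + 2 * (cmod (g x))\<^sup>2" for x
  proof -
    have "(cmod (f x + g x))\<^sup>2 \<le> (cmod (f x) + cmod (g x))\<^sup>2"
      by (intro power_mono norm_triangle_ineq) auto
    also have "\<dots> \<le> 2 * (cmod (f x))\<^sup>2 + 2 * (cmod (g x))\<^sup>2"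
      using sum_squares_bound[of "cmod (f x)" "cmod (g x)"] by (simp add: power2_sum)
    finally show ?thesis .
  qed
  moreover have "(\<lambda>x. 2 * (cmod (f x))\<^sup>2 + 2 * (cmod (g x))\<^sup>2) summable_on UNIV"
    by (rule summable_on_add; rule summable_on_cmult_right; rule ell2_summable; fact assms)
  ultimately have "(\<lambda>x. (cmod (f x + g x))\<^sup>2) summable_on UNIV"
    by (intro summable_on_comparison_test[of "\<lambda>x. 2 * (cmod (f x))\<^sup>2 + 2 * (cmod (g x))\<^sup>2" UNIV
          "\<lambda>x. (cmod (f x + g x))\<^sup>2"] zero_le_power2)
  then show ?thesis using assms by (auto simp: ell2_iff)
qed

lemma ell2_diff:
  assumes "f \<in> ell2 B" "g \<in> ell2 B"
  shows "(\<lambda>x. f x - g x) \<in> ell2 B"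
  using ell2_add[OF assms(1) ell2_scale[OF assms(2), of "-1"]] by simp

lemma ket_in_ell2:
  assumes "C \<in> B"
  shows "ket C \<in> ell2 B"
proof -
  have "(\<lambda>x. (cmod (ket C x))\<^sup>2) summable_on UNIV \<longleftrightarrow> (\<lambda>x. (cmod (ket C x))\<^sup>2) summable_on {C}"
    by (rule summable_on_cong_neutral) (auto simp: ket_def)
  then show ?thesis using assms by (auto simp: ell2_iff ket_def)
qed

lemma ket_apply: "ket C D = (if D = C then 1 else 0)"
  by (simp add: ket_def)

lemma inj_ket: "ket C = ket D \<longleftrightarrow> C = D"
  by (metis ket_apply zero_neq_one)

lemma infsum_single:
  fixes f :: "'c \<Rightarrow> 'd::{topological_comm_monoid_add, t2_space}"
  assumes "\<And>y. y \<noteq> x \<Longrightarrow> f y = 0"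
  shows "infsum f UNIV = f x"
proof -
  have "infsum f UNIV = infsum f {x}"
    by (rule infsum_cong_neutral) (use assms in auto)
  then show ?thesis by simp
qed

lemma ell2_inner_ket_left: "ell2_inner (ket C) f = f C"
  unfolding ell2_inner_def by (subst infsum_single[of C]) (auto simp: ket_apply)

lemma ell2_inner_ket_right: "ell2_inner f (ket C) = cnj (f C)"
  unfolding ell2_inner_def by (subst infsum_single[of C]) (auto simp: ket_apply)

lemma ell2_inner_self:
  assumes "f \<in> ell2 B"
  shows "ell2_inner f f = complex_of_real (\<Sum>\<^sub>\<infinity>x. (cmod (f x))\<^sup>2)"
proof -
  have "cnj (f x) * f x = complex_of_real ((cmod (f x))\<^sup>2)" for x
    by (metis complex_norm_square mult.commute)
  then have "ell2_inner f f = (\<Sum>\<^sub>\<infinity>x. complex_of_real ((cmod (f x))\<^sup>2))"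
    unfolding ell2_inner_def by presburger
  also have "\<dots> = complex_of_real (\<Sum>\<^sub>\<infinity>x. (cmod (f x))\<^sup>2)"
    by (rule infsumI, rule has_sum_of_real) (rule has_sum_infsum, rule ell2_summable, fact assms)
  finally show ?thesis .
qed

lemma ell2_norm_nonneg: "ell2_norm f \<ge> 0"
  by (simp add: ell2_norm_def infsum_nonneg)

lemma ell2_norm_power2: "(ell2_norm f)\<^sup>2 = (\<Sum>\<^sub>\<infinity>x. (cmod (f x))\<^sup>2)"
  by (simp add: ell2_norm_def infsum_nonneg)

lemma ell2_norm_scale: "ell2_norm (\<lambda>x. a * f x) = cmod a * ell2_norm f"
proof -
  have "(\<Sum>\<^sub>\<infinity>x. (cmod (a * f x))\<^sup>2) = (cmod a)\<^sup>2 * (\<Sum>\<^sub>\<infinity>x. (cmod (f x))\<^sup>2)"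
    by (simp add: norm_mult power_mult_distrib infsum_cmult_right')
  then show ?thesis by (simp add: ell2_norm_def real_sqrt_mult)
qed

lemma infsum_subset_le_ell2_norm:
  assumes "f \<in> ell2 B"
  shows "(\<Sum>\<^sub>\<infinity>x\<in>A. (cmod (f x))\<^sup>2) \<le> (ell2_norm f)\<^sup>2"
  unfolding ell2_norm_power2
  by (rule infsum_mono_neutral) (auto intro: ell2_summable[OF assms])

lemma cmod_le_ell2_norm:
  assumes "f \<in> ell2 B"
  shows "cmod (f x) \<le> ell2_norm f"
  using infsum_subset_le_ell2_norm[OF assms, of "{x}"] ell2_norm_nonneg
  by (auto intro: power2_le_imp_le)

lemma ell2_norm_mono:
  assumes "f \<in> ell2 B" "\<And>x. cmod (g x) \<le> cmod (f x)"
  shows "ell2_norm g \<le> ell2_norm f"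
  unfolding ell2_norm_def
  by (intro real_sqrt_le_mono infsum_mono power_mono assms(2) norm_ge_zero
      ell2_summable[OF assms(1)] ell2_summable[OF ell2_dominated[OF assms]])

lemma ell2_norm_pos:
  assumes "f \<in> ell2 B" "f x \<noteq> 0"
  shows "ell2_norm f > 0"
proof -
  have "0 < cmod (f x)" using assms(2) by simp
  also have "\<dots> \<le> ell2_norm f" by (rule cmod_le_ell2_norm[OF assms(1)])
  finally show ?thesis .
qed

text \<open>Finite partial sums of the squares approach their total, so the remaining part is small.
  This is the density of finite combinations of kets in the form used below.\<close>

lemma ell2_small_tail:
  assumes "f \<in> ell2 B" "e > 0"
  shows "\<exists>F. finite F \<and> ell2_norm (\<lambda>x. if x \<in> F then 0 else f x) \<le> e"
proof -
  let ?g = "\<lambda>x. (cmod (f x))\<^sup>2"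
  have "?g summable_on UNIV" using assms(1) by (rule ell2_summable)
  then have "(?g has_sum infsum ?g UNIV) UNIV" by simp
  then have "\<forall>\<^sub>F F in finite_subsets_at_top UNIV. dist (sum ?g F) (infsum ?g UNIV) < e\<^sup>2"
    unfolding has_sum_def using \<open>e > 0\<close> by (intro tendstoD) auto
  then obtain F where F: "finite F" "dist (sum ?g F) (infsum ?g UNIV) < e\<^sup>2"
    by (auto simp: eventually_finite_subsets_at_top)
  have "infsum (\<lambda>x. (cmod (if x \<in> F then 0 else f x))\<^sup>2) UNIV = infsum ?g (UNIV - F)"
    by (rule infsum_cong_neutral) auto
  also have "\<dots> = infsum ?g UNIV - infsum ?g F"
    using F(1) \<open>?g summable_on UNIV\<close> by (intro infsum_Diff) auto
  also have "\<dots> \<le> e\<^sup>2" using F by (simp add: dist_real_def)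
  finally have "(ell2_norm (\<lambda>x. if x \<in> F then 0 else f x))\<^sup>2 \<le> e\<^sup>2"
    by (simp add: ell2_norm_power2)
  then have "ell2_norm (\<lambda>x. if x \<in> F then 0 else f x) \<le> e"
    by (rule power2_le_imp_le) (use \<open>e > 0\<close> in simp)
  then show ?thesis using F(1) by blast
qed


section \<open>Bounded and unitary operators\<close>

lemma bounded_operator_ell2: "bounded_operator B U \<Longrightarrow> f \<in> ell2 B \<Longrightarrow> U f \<in> ell2 B"
  by (auto simp: bounded_operator_def)

lemma bounded_operator_add:
  "bounded_operator B U \<Longrightarrow> f \<in> ell2 B \<Longrightarrow> g \<in> ell2 B \<Longrightarrow> U (\<lambda>x. f x + g x) = (\<lambda>x. U f x + U g x)"
  by (simp add: bounded_operator_def)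

lemma bounded_operator_scale:
  "bounded_operator B U \<Longrightarrow> f \<in> ell2 B \<Longrightarrow> U (\<lambda>x. a * f x) = (\<lambda>x. a * U f x)"
  by (simp add: bounded_operator_def)

lemma bounded_operator_diff:
  assumes "bounded_operator B U" "f \<in> ell2 B" "g \<in> ell2 B"
  shows "U (\<lambda>x. f x - g x) = (\<lambda>x. U f x - U g x)"
  using bounded_operator_add[OF assms(1,2) ell2_scale[OF assms(3), of "-1"]]
    bounded_operator_scale[OF assms(1,3), of "-1"] by simp

lemma bounded_operator_bound:
  assumes "bounded_operator B U"
  shows "\<exists>K\<ge>0. \<forall>f\<in>ell2 B. ell2_norm (U f) \<le> K * ell2_norm f"
proof -
  obtain K where K: "\<And>f. f \<in> ell2 B \<Longrightarrow> ell2_norm (U f) \<le> K * ell2_norm f"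
    using assms unfolding bounded_operator_def by blast
  show ?thesis
  proof (intro exI[of _ "\<bar>K\<bar>"] conjI ballI)
    fix f assume "f \<in> ell2 B"
    then have "ell2_norm (U f) \<le> K * ell2_norm f" by (rule K)
    also have "\<dots> \<le> \<bar>K\<bar> * ell2_norm f" by (intro mult_right_mono ell2_norm_nonneg) auto
    finally show "ell2_norm (U f) \<le> \<bar>K\<bar> * ell2_norm f" .
  qed auto
qed

text \<open>Linearity gives agreement on truncations to finite sets, and boundedness makes the
  contribution of the tail as small as desired in every coordinate.\<close>

lemma bounded_operator_eqI:
  assumes U: "bounded_operator B U" and W: "bounded_operator B W"
    and ket: "\<And>C. C \<in> B \<Longrightarrow> U (ket C) = W (ket C)"
  shows "U = W"
proof
  fix f
  show "U f = W f"
  proof (cases "f \<in> ell2 B")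
    case False
    \<comment> \<open>Operators are extensional, so off the space both take the default
      value.\<close>
    then have "U f = undefined" "W f = undefined"
      using U W PiE_arb[of U "ell2 B"] PiE_arb[of W "ell2 B"]
      unfolding bounded_operator_def by blast+
    then show ?thesis by simp
  next
    case f: True
    let ?head = "\<lambda>F x. if x \<in> F then f x else 0" and ?tail = "\<lambda>F x. if x \<in> F then 0 else f x"
    have head: "?head F \<in> ell2 B" and tail: "?tail F \<in> ell2 B" for F
      by (rule ell2_dominated[OF f]; simp)+
    have finite: "U (?head F) = W (?head F)" if "finite F" for F
      using that
    proof induction
      case empty
      \<comment> \<open>The zero family is \<open>0\<close> times \<open>f\<close>, so homogeneity
        settles the empty truncation.\<close>
      show ?case
        using bounded_operator_scale[OF U f, of 0] bounded_operator_scale[OF W f, of 0] by simp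
    next
      case (insert y F)
      show ?case
      proof (cases "y \<in> B")
        case True
        have split: "?head (insert y F) = (\<lambda>x. ?head F x + f y * ket y x)"
          using insert by (auto simp: ket_apply fun_eq_iff)
        show ?thesis
          unfolding split
          unfolding bounded_operator_add[OF U head ell2_scale[OF ket_in_ell2[OF True]]]
            bounded_operator_add[OF W head ell2_scale[OF ket_in_ell2[OF True]]]
            bounded_operator_scale[OF U ket_in_ell2[OF True]]
            bounded_operator_scale[OF W ket_in_ell2[OF True]] insert.IH ket[OF True] ..
      next
        case False
        then have "?head (insert y F) = ?head F"
          using ell2_outside[OF f] by (auto simp: fun_eq_iff)
        then show ?thesis using insert by simp
      qed
    qed
    obtain K where K: "K \<ge> 0" "\<And>f. f \<in> ell2 B \<Longrightarrow> ell2_norm (U f) \<le> K * ell2_norm f"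
      using bounded_operator_bound[OF U] by blast
    obtain L where L: "L \<ge> 0" "\<And>f. f \<in> ell2 B \<Longrightarrow> ell2_norm (W f) \<le> L * ell2_norm f"
      using bounded_operator_bound[OF W] by blast
    have "U f x = W f x" for x
    proof -
      have "cmod (U f x - W f x) \<le> e" if "e > 0" for e
      proof -
        \<comment> \<open>Chosen so that \<open>K * d + L * d \<le> e\<close>; the summand
          \<open>1\<close> keeps the denominator positive when both bounds are
          \<open>0\<close>.\<close>
        define d where "d = e / (K + L + 1)"
        have "d > 0" using that K L by (simp add: d_def)
        then obtain F where F: "finite F" "ell2_norm (?tail F) \<le> d"
          using ell2_small_tail[OF f] by blast
        have split: "f = (\<lambda>x. ?head F x + ?tail F x)" by auto
        have "U f = (\<lambda>x. U (?head F) x + U (?tail F) x)"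
          by (subst split) (rule bounded_operator_add[OF U head tail])
        moreover have "W f = (\<lambda>x. W (?head F) x + W (?tail F) x)"
          by (subst split) (rule bounded_operator_add[OF W head tail])
        ultimately have "cmod (U f x - W f x) = cmod (U (?tail F) x - W (?tail F) x)"
          using finite[OF F(1)] by simp
        also have "\<dots> \<le> cmod (U (?tail F) x) + cmod (W (?tail F) x)"
          by (rule norm_triangle_ineq4)
        also have "\<dots> \<le> ell2_norm (U (?tail F)) + ell2_norm (W (?tail F))"
          using bounded_operator_ell2[OF U tail] bounded_operator_ell2[OF W tail]
          by (intro add_mono cmod_le_ell2_norm)
        also have "\<dots> \<le> K * ell2_norm (?tail F) + L * ell2_norm (?tail F)"
          by (intro add_mono K L tail)
        also have "\<dots> \<le> (K + L + 1) * ell2_norm (?tail F)"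
          using ell2_norm_nonneg[of "?tail F"] by (simp add: algebra_simps)
        also have "\<dots> \<le> (K + L + 1) * d" using F K L by (intro mult_left_mono) auto
        also have "\<dots> = e" using K L by (simp add: d_def)
        finally show ?thesis .
      qed
      then have "cmod (U f x - W f x) \<le> 0" by (rule field_le_epsilon) auto
      then show ?thesis by simp
    qed
    then show ?thesis by blast
  qed
qed

lemma unitary_bounded: "unitary_operator B U \<Longrightarrow> bounded_operator B U"
  by (simp add: unitary_operator_def)

definition adjoint_inverse where
  "adjoint_inverse B U = (SOME V. bounded_operator B V \<and>
     (\<forall>f\<in>ell2 B. \<forall>g\<in>ell2 B. ell2_inner (U f) g = ell2_inner f (V g)) \<and>
     (\<forall>f\<in>ell2 B. V (U f) = f \<and> U (V f) = f))"

lemma adjoint_inverse: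
  assumes "unitary_operator B U"
  shows "\<forall>f\<in>ell2 B. \<forall>g\<in>ell2 B. ell2_inner (U f) g = ell2_inner f (adjoint_inverse B U g)"
    and "\<forall>f\<in>ell2 B. adjoint_inverse B U (U f) = f"
  using someI_ex[OF conjunct2[OF assms[unfolded unitary_operator_def]]]
  unfolding adjoint_inverse_def by blast+

lemma unitary_inner:
  assumes "unitary_operator B U" "f \<in> ell2 B" "g \<in> ell2 B"
  shows "ell2_inner (U f) (U g) = ell2_inner f g"
proof -
  have "U g \<in> ell2 B" by (rule bounded_operator_ell2[OF unitary_bounded[OF assms(1)] assms(3)])
  then have "ell2_inner (U f) (U g) = ell2_inner f (adjoint_inverse B U (U g))"
    using adjoint_inverse(1)[OF assms(1)] assms(2) by blast
  also have "adjoint_inverse B U (U g) = g" using adjoint_inverse(2)[OF assms(1)] assms(3) by blast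
  finally show ?thesis .
qed

lemma unitary_norm:
  assumes "unitary_operator B U" "f \<in> ell2 B"
  shows "ell2_norm (U f) = ell2_norm f"
  using unitary_inner[OF assms(1,2,2)]
  by (simp only: ell2_inner_self[OF assms(2)] ell2_norm_def of_real_eq_iff
      ell2_inner_self[OF bounded_operator_ell2[OF unitary_bounded[OF assms(1)] assms(2)]])

text \<open>Pairing with a ket reads off a coordinate, and \<open>U\<close> preserves inner
  products, so the pairing with \<open>ket C\<close> becomes the pairing with its image
  \<open>ket D\<close>.\<close>

lemma unitary_ket_transport:
  assumes "unitary_operator B U" "f \<in> ell2 B" "C \<in> B" "U (ket C) = ket D"
  shows "U f D = f C"
  using unitary_inner[OF assms(1) ket_in_ell2[OF assms(3)] assms(2)] assms(4)
  by (simp add: ell2_inner_ket_left)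

text \<open>The coordinate at \<open>D\<close> is, up to conjugation, the pairing of
  \<open>f\<close> with the adjoint image of \<open>ket D\<close>. On the support of
  \<open>f\<close> that image vanishes, because \<open>U\<close> sends each such ket to a ket
  orthogonal to \<open>ket D\<close>. No expansion of \<open>U f\<close> as an infinite series is
  needed.\<close>

lemma unitary_vanish:
  assumes "unitary_operator B U" "f \<in> ell2 B" "D \<in> B"
    and "\<And>C. f C \<noteq> 0 \<Longrightarrow> \<exists>E. U (ket C) = ket E \<and> E \<noteq> D"
  shows "U f D = 0"
proof -
  define V where "V = adjoint_inverse B U"
  have V: "\<forall>f\<in>ell2 B. \<forall>g\<in>ell2 B. ell2_inner (U f) g = ell2_inner f (V g)"
    unfolding V_def by (rule adjoint_inverse(1)[OF assms(1)])
  have "cnj (U f D) = ell2_inner f (V (ket D))"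
    using V assms(2) ket_in_ell2[OF assms(3)] by (metis ell2_inner_ket_right)
  also have "\<dots> = 0"
    unfolding ell2_inner_def
  proof (rule infsum_0)
    fix C
    show "cnj (f C) * V (ket D) C = 0"
    proof (cases "f C = 0")
      case False
      then have "C \<in> B" using ell2_outside[OF assms(2)] by blast
      obtain E where E: "U (ket C) = ket E" "E \<noteq> D" using assms(4)[OF False] by blast
      have "V (ket D) C = ell2_inner (U (ket C)) (ket D)"
        using V ket_in_ell2[OF \<open>C \<in> B\<close>] ket_in_ell2[OF assms(3)]
        by (metis ell2_inner_ket_left)
      also have "\<dots> = 0" using E by (simp add: ell2_inner_ket_right ket_apply)
      finally show ?thesis by simp
    qed simp
  qed
  finally show ?thesis by simp
qed


section \<open>Configurations\<close>

lemma equiv_config_rel: "equiv (raw_configs M) (config_rel M)"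
proof (rule equivI)
  show "config_rel M \<subseteq> raw_configs M \<times> raw_configs M" by (auto simp: config_rel_def)
  show "refl_on (raw_configs M) (config_rel M)"
    by (auto simp: refl_on_def config_rel_def)
  show "sym (config_rel M)"
    unfolding config_rel_def by (rule symI) (clarsimp, metis)
  show "trans (config_rel M)"
  proof (rule transI)
    fix x y z assume "(x, y) \<in> config_rel M" "(y, z) \<in> config_rel M"
    then obtain a q b n a' b' a'' b'' i j k l i' j' k' l' where
      eqs: "x = (a, q, b, n)" "y = (a', q, b', n)" "z = (a'', q, b'', n)"
      "x \<in> raw_configs M" "z \<in> raw_configs M"
      "replicate i (blank M) @ a = replicate j (blank M) @ a'"
      "replicate k (blank M) @ a' = replicate l (blank M) @ a''"
      "b @ replicate i' (blank M) = b' @ replicate j' (blank M)"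
      "b' @ replicate k' (blank M) = b'' @ replicate l' (blank M)"
      by (auto simp: config_rel_def)
    \<comment> \<open>The two paddings of the middle tape are merged into a common one, since blocks
      of blanks commute. The right tapes are treated in the same way.\<close>
    have "replicate (k + i) (blank M) @ a = replicate k (blank M) @ replicate j (blank M) @ a'"
      by (simp add: replicate_add eqs)
    also have "\<dots> = replicate j (blank M) @ replicate k (blank M) @ a'"
      by (metis add.commute append_assoc replicate_add)
    also have "\<dots> = replicate (j + l) (blank M) @ a''" by (simp add: replicate_add eqs)
    finally have left: "replicate (k + i) (blank M) @ a = replicate (j + l) (blank M) @ a''" .
    have "b @ replicate (i' + k') (blank M) = b' @ replicate j' (blank M) @ replicate k' (blank M)"
      by (simp add: replicate_add) (metis append_assoc eqs(8))
    also have "\<dots> = b' @ replicate k' (blank M) @ replicate j' (blank M)"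
      by (metis add.commute replicate_add)
    also have "\<dots> = b'' @ replicate (l' + j') (blank M)"
      by (simp add: replicate_add) (metis append_assoc eqs(9))
    finally have right: "b @ replicate (i' + k') (blank M) = b'' @ replicate (l' + j') (blank M)" .
    show "(x, z) \<in> config_rel M"
      using eqs(4,5) left right unfolding eqs(1-3) config_rel_def by blast
  qed
qed

lemma config_of_eq_iff:
  "c \<in> raw_configs M \<Longrightarrow> d \<in> raw_configs M \<Longrightarrow> config_of M c = config_of M d \<longleftrightarrow> (c, d) \<in> config_rel M"
  unfolding config_of_def by (rule eq_equiv_class_iff[OF equiv_config_rel])

lemma config_of_self: "c \<in> raw_configs M \<Longrightarrow> c \<in> config_of M c"
  unfolding config_of_def by (rule equiv_class_self[OF equiv_config_rel])

lemma config_of_in_configs: "c \<in> raw_configs M \<Longrightarrow> config_of M c \<in> configs M"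
  unfolding config_of_def configs_def by (rule quotientI)

lemma configs_cases:
  assumes "C \<in> configs M"
  obtains \<alpha> q \<beta> n where "(\<alpha>, q, \<beta>, n) \<in> raw_configs M" "C = config_of M (\<alpha>, q, \<beta>, n)"
  using assms unfolding configs_def config_of_def by (metis quotientE prod_cases4)

lemma configs_in_state_subset: "configs_in_state M q \<subseteq> configs M"
  by (auto simp: configs_in_state_def intro: config_of_in_configs)

lemma configs_in_state_disjoint:
  assumes "q \<noteq> r"
  shows "configs_in_state M q \<inter> configs_in_state M r = {}"
  using assms by (auto simp: configs_in_state_def config_of_eq_iff) (auto simp: config_rel_def)

lemma config_val_config_of:
  assumes "one M \<noteq> blank M" "(\<alpha>, q, \<beta>, n) \<in> raw_configs M"
  shows "config_val M (config_of M (\<alpha>, q, \<beta>, n)) = count_list (\<alpha> @ \<beta>) (one M)"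
proof -
  have replicate: "count_list (replicate j (blank M)) (one M) = 0" for j
    using assms(1) by (induction j) auto
  have "count_list (\<alpha>' @ \<beta>') (one M) = count_list (\<alpha> @ \<beta>) (one M)"
    if mem: "(\<alpha>', q', \<beta>', n') \<in> config_of M (\<alpha>, q, \<beta>, n)" for \<alpha>' q' \<beta>' n'
  proof -
    obtain i j k l where
      "replicate i (blank M) @ \<alpha> = replicate j (blank M) @ \<alpha>'"
      "\<beta> @ replicate k (blank M) = \<beta>' @ replicate l (blank M)"
      using mem by (auto simp: config_of_def config_rel_def)
    from arg_cong[OF this(1), of "\<lambda>x. count_list x (one M)"]
      arg_cong[OF this(2), of "\<lambda>x. count_list x (one M)"]
    show ?thesis by (simp add: replicate)
  qed
  then show ?thesis
    unfolding config_val_def using config_of_self[OF assms(2)]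
    by (intro the_equality) blast+
qed

section \<open>Clauses and uniqueness of the time evolution\<close>

lemma
  assumes "is_time_evolution M U" "\<alpha> \<in> lists (alphabet M)" "\<beta> \<in> lists (alphabet M)"
  shows time_evolution_step: "q \<in> states M - targets M \<Longrightarrow> u \<in> alphabet M \<Longrightarrow>
      U (ket (config_of M (\<alpha>, q, u # \<beta>, 0))) =
        (\<lambda>D. \<Sum>m\<in>moves M. delta M (q, u) m * ket (moved M \<alpha> \<beta> m) D)"
    and time_evolution_source: "q \<in> sources M \<Longrightarrow> n > 0 \<Longrightarrow>
      U (ket (config_of M (\<alpha>, q, \<beta>, n))) = ket (config_of M (\<alpha>, q, \<beta>, n - 1))"
    and time_evolution_target: "q \<in> targets M \<Longrightarrow>
      U (ket (config_of M (\<alpha>, q, \<beta>, n))) = ket (config_of M (\<alpha>, q, \<beta>, n + 1))"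
  using assms unfolding is_time_evolution_def by blast+

text \<open>Every configuration has a representative to which one of the clauses of the time evolution
  applies: an empty right tape is padded with a blank.\<close>

lemma time_evolution_unique:
  assumes M: "pre_qtm M" and U: "is_time_evolution M U" and W: "is_time_evolution M W"
  shows "U = W"
proof (rule bounded_operator_eqI)
  show "bounded_operator (configs M) U" "bounded_operator (configs M) W"
    using U W by (auto simp: is_time_evolution_def)
  fix C assume "C \<in> configs M"
  then obtain \<alpha> q \<beta> n where c: "(\<alpha>, q, \<beta>, n) \<in> raw_configs M" and C: "C = config_of M (\<alpha>, q, \<beta>, n)"
    by (rule configs_cases)
  have \<alpha>: "\<alpha> \<in> lists (alphabet M)" and \<beta>: "\<beta> \<in> lists (alphabet M)" and q: "q \<in> states M"
    and n: "q \<notin> sources M \<union> targets M \<longrightarrow> n = 0"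
    using c by (auto simp: raw_configs_def)
  \<comment> \<open>Exhaustive because a positive counter outside the targets forces a source
    state.\<close>
  consider "q \<in> targets M" | "q \<in> sources M" "n > 0" | "q \<notin> targets M" "n = 0"
    using n by blast
  then show "U (ket C) = W (ket C)"
  proof cases
    case 1
    then show ?thesis unfolding C by (simp add: time_evolution_target[OF U \<alpha> \<beta>] time_evolution_target[OF W \<alpha> \<beta>])
  next
    case 2
    then show ?thesis unfolding C by (simp add: time_evolution_source[OF U \<alpha> \<beta>] time_evolution_source[OF W \<alpha> \<beta>])
  next
    case 3
    obtain u \<gamma> where u: "u \<in> alphabet M" "\<gamma> \<in> lists (alphabet M)"
      and eq: "C = config_of M (\<alpha>, q, u # \<gamma>, 0)"
    proof (cases \<beta>)
      case Nil
      have blank: "blank M \<in> alphabet M" using M by (simp add: pre_qtm_def)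
      have c': "(\<alpha>, q, [blank M], 0) \<in> raw_configs M"
        using \<alpha> q blank by (auto simp: raw_configs_def)
      have "[] @ replicate 1 (blank M) = [blank M] @ replicate 0 (blank M)" by simp
      then have "((\<alpha>, q, [], 0), (\<alpha>, q, [blank M], 0)) \<in> config_rel M"
        using c c' Nil 3 unfolding config_rel_def by blast
      then have "C = config_of M (\<alpha>, q, [blank M], 0)"
        using c c' Nil 3 unfolding C by (simp add: config_of_eq_iff)
      then show ?thesis using that blank by blast
    next
      case (Cons u \<gamma>)
      then show ?thesis using that[of u \<gamma>] \<beta> C 3 by auto
    qed
    have "q \<in> states M - targets M" using q 3 by blast
    then show ?thesis
      by (simp only: eq time_evolution_step[OF U \<alpha> u(2) _ u(1)]
          time_evolution_step[OF W \<alpha> u(2) _ u(1)])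
  qed
qed

text \<open>Existence is part of \<open>qtm\<close>; together with uniqueness it makes the definite
  description in \<open>evolution\<close> denote.\<close>

lemma qtm_time_evolution:
  assumes "qtm M"
  shows "is_time_evolution M (evolution M)"
proof -
  obtain U where U: "is_time_evolution M U" and M: "pre_qtm M"
    using assms unfolding qtm_def by blast
  then have "\<exists>!U. is_time_evolution M U" using time_evolution_unique by (intro ex1I) auto
  then show ?thesis unfolding evolution_def by (rule theI')
qed

subsection \<open>Advancing the counter of a final configuration\<close>

text \<open>Acting on all representatives at once avoids choosing one and makes the map injective on
  arbitrary sets.\<close>

definition advance :: "('a, 's) config \<Rightarrow> ('a, 's) config" where
  "advance C = (\<lambda>(\<alpha>, q, \<beta>, n). (\<alpha>, q, \<beta>, Suc n)) ` C"

text \<open>The starting points of the counter chains into which the final configurations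
  decompose.\<close>

definition entry_configs :: "('a, 's) machine \<Rightarrow> ('a, 's) config set" where
  "entry_configs M =
     {C. \<exists>\<alpha> \<beta>. (\<alpha>, final_state M, \<beta>, 0) \<in> raw_configs M \<and>
        C = config_of M (\<alpha>, final_state M, \<beta>, 0)}"

lemma advance_eq_iff: "advance C = advance D \<longleftrightarrow> C = D"
proof -
  have "inj (\<lambda>(\<alpha>, q, \<beta>, n). (\<alpha>, q, \<beta>, Suc n))" by (auto simp: inj_def)
  then show ?thesis unfolding advance_def by (rule inj_image_eq_iff)
qed

lemma advance_config_of:
  assumes "q \<in> targets M"
  shows "advance (config_of M (\<alpha>, q, \<beta>, n)) = config_of M (\<alpha>, q, \<beta>, Suc n)" (is "?L = ?R")
proof
  show "?L \<subseteq> ?R"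
    using assms by (auto simp: advance_def config_of_def config_rel_def raw_configs_def)
  show "?R \<subseteq> ?L"
  proof
    fix c assume c: "c \<in> ?R"
    obtain \<alpha>' q' \<beta>' n' where eq: "c = (\<alpha>', q', \<beta>', n')" by (rule prod_cases4)
    have "n' = Suc n" using c by (auto simp: eq config_of_def config_rel_def)
    moreover have "(\<alpha>', q', \<beta>', n) \<in> config_of M (\<alpha>, q, \<beta>, n)"
      using c assms by (auto simp: eq config_of_def config_rel_def raw_configs_def)
    ultimately show "c \<in> ?L" unfolding advance_def eq by force
  qed
qed

lemma entry_subset_final: "entry_configs M \<subseteq> final_configs M"
  by (auto simp: entry_configs_def final_configs_def configs_in_state_def)

lemma advance_notin_entry: "advance C \<notin> entry_configs M"
proof
  assume "advance C \<in> entry_configs M"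
  then obtain \<alpha> \<beta> where "(\<alpha>, final_state M, \<beta>, 0) \<in> advance C"
    using config_of_self by (fastforce simp: entry_configs_def)
  then show False by (auto simp: advance_def)
qed

text \<open>Injectivity strips advances from both sides, and an entry configuration is never itself
  advanced. Hence a final configuration has only one entry point and one counter value.\<close>

lemma advance_pow_eq_iff:
  assumes "D \<in> entry_configs M" "D' \<in> entry_configs M"
  shows "(advance ^^ m) D = (advance ^^ m') D' \<longleftrightarrow> m = m' \<and> D = D'"
proof (induction m arbitrary: m')
  case 0
  then show ?case using assms advance_notin_entry by (cases m') auto
next
  case (Suc m)
  then show ?case using assms by (cases m') (auto simp: advance_eq_iff advance_notin_entry)
qed

lemma advance_final:
  assumes M: "pre_qtm M" and C: "C \<in> final_configs M"
  shows "advance C \<in> final_configs M" and "config_val M (advance C) = config_val M C"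
proof -
  have q: "final_state M \<in> targets M" and one: "one M \<noteq> blank M" using M by (auto simp: pre_qtm_def)
  obtain \<alpha> \<beta> n where c: "(\<alpha>, final_state M, \<beta>, n) \<in> raw_configs M"
    and C: "C = config_of M (\<alpha>, final_state M, \<beta>, n)"
    using C by (auto simp: final_configs_def configs_in_state_def)
  have c': "(\<alpha>, final_state M, \<beta>, Suc n) \<in> raw_configs M" using c q by (auto simp: raw_configs_def)
  show "advance C \<in> final_configs M"
    using c' by (auto simp: C advance_config_of[OF q] final_configs_def configs_in_state_def)
  show "config_val M (advance C) = config_val M C"
    by (simp add: C advance_config_of[OF q] config_val_config_of[OF one c] config_val_config_of[OF one c'])
qed

lemma advance_pow_final:
  assumes "pre_qtm M" "C \<in> final_configs M"
  shows "(advance ^^ m) C \<in> final_configs M \<and> config_val M ((advance ^^ m) C) = config_val M C"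
  using assms by (induction m) (auto simp: advance_final)

lemma final_configs_cases:
  assumes M: "pre_qtm M" and C: "C \<in> final_configs M"
  obtains m D where "D \<in> entry_configs M" "C = (advance ^^ m) D"
proof -
  have q: "final_state M \<in> targets M" using M by (auto simp: pre_qtm_def)
  obtain \<alpha> \<beta> n where c: "(\<alpha>, final_state M, \<beta>, n) \<in> raw_configs M"
    and C: "C = config_of M (\<alpha>, final_state M, \<beta>, n)"
    using C by (auto simp: final_configs_def configs_in_state_def)
  have c': "(\<alpha>, final_state M, \<beta>, 0) \<in> raw_configs M" using c q by (auto simp: raw_configs_def)
  have "config_of M (\<alpha>, final_state M, \<beta>, n) = (advance ^^ n) (config_of M (\<alpha>, final_state M, \<beta>, 0))"
    by (induction n) (auto simp: advance_config_of[OF q, symmetric])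
  then show ?thesis using that c' unfolding C entry_configs_def by blast
qed

lemma time_evolution_final:
  assumes "pre_qtm M" "is_time_evolution M U" "C \<in> final_configs M"
  shows "U (ket C) = ket (advance C)"
proof -
  have q: "final_state M \<in> targets M" using assms(1) by (auto simp: pre_qtm_def)
  obtain \<alpha> \<beta> n where c: "(\<alpha>, final_state M, \<beta>, n) \<in> raw_configs M"
    and C: "C = config_of M (\<alpha>, final_state M, \<beta>, n)"
    using assms(3) by (auto simp: final_configs_def configs_in_state_def)
  show ?thesis
    using time_evolution_target[OF assms(2) _ _ q] c
    by (auto simp: C advance_config_of[OF q] raw_configs_def)
qed

text \<open>A state that is both source and target would have its counter both lowered and raised:
  from counter \<open>1\<close>, \<open>U\<close> would have to reach the distinct configurations
  with counters \<open>0\<close> and \<open>2\<close>.\<close>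

lemma init_neq_final_state:
  assumes "pre_qtm M" "is_time_evolution M U"
  shows "init_state M \<noteq> final_state M"
proof
  assume "init_state M = final_state M"
  then have q: "init_state M \<in> sources M" "init_state M \<in> targets M" "init_state M \<in> states M"
    using assms(1) by (auto simp: pre_qtm_def)
  have raw: "([], init_state M, [], n) \<in> raw_configs M" for n
    using q by (auto simp: raw_configs_def)
  have "U (ket (config_of M ([], init_state M, [], 1))) = ket (config_of M ([], init_state M, [], 0))"
    using time_evolution_source[OF assms(2) _ _ q(1), of "[]" "[]" 1] by simp
  moreover have "U (ket (config_of M ([], init_state M, [], 1))) = ket (config_of M ([], init_state M, [], 2))"
    using time_evolution_target[OF assms(2) _ _ q(2), of "[]" "[]" 1] by (simp add: numeral_2_eq_2)
  ultimately have "config_of M ([], init_state M, [], 0) = config_of M ([], init_state M, [], 2)"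
    by (simp add: inj_ket)
  then show False by (simp add: config_of_eq_iff[OF raw raw] config_rel_def)
qed

lemma init_final_disjoint:
  assumes "qtm M"
  shows "init_configs M \<inter> final_configs M = {}"
  unfolding init_configs_def final_configs_def
  using assms init_neq_final_state qtm_time_evolution
  by (intro configs_in_state_disjoint) (auto simp: qtm_def)


section \<open>Output observations\<close>

text \<open>The support of the collapsed q-configuration reveals the outcome: a value leaves a
  single final configuration, whereas \<open>None\<close> leaves nothing on final
  configurations.\<close>

lemma output_observation_unique:
  assumes "output_observation M \<psi> x \<psi>' p" "output_observation M \<psi> y \<psi>' q"
  shows "x = y \<and> p = q"
proof -
  have distinct: "C \<in> final_configs M \<Longrightarrow> \<psi> C \<noteq> 0 \<Longrightarrow>
      (\<lambda>D. \<psi> C / complex_of_real (cmod (\<psi> C)) * ket C D) \<noteq>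
      (\<lambda>D. nonfinal_part M \<psi> D / complex_of_real (ell2_norm (nonfinal_part M \<psi>)))" for C
    by (auto simp: fun_eq_iff nonfinal_part_def ket_apply intro!: exI[of _ C])
  have same: "C = D" if "\<psi> C \<noteq> 0" "(\<lambda>E. \<psi> C / complex_of_real (cmod (\<psi> C)) * ket C E) =
      (\<lambda>E. \<psi> D / complex_of_real (cmod (\<psi> D)) * ket D E)" for C D
    using fun_cong[OF that(2), of C] that(1) by (auto simp: ket_apply split: if_splits)
  from assms show ?thesis
  proof (elim output_observation.cases)
    fix C m D n
    assume eq: "x = Some m" "y = Some n" "p = (cmod (\<psi> C))\<^sup>2" "q = (cmod (\<psi> D))\<^sup>2"
      "config_val M C = m" "config_val M D = n"
      and \<psi>': "\<psi>' = (\<lambda>E. \<psi> C / complex_of_real (cmod (\<psi> C)) * ket C E)"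
        "\<psi>' = (\<lambda>E. \<psi> D / complex_of_real (cmod (\<psi> D)) * ket D E)"
      and "\<psi> C \<noteq> 0"
    have "C = D" by (rule same[OF \<open>\<psi> C \<noteq> 0\<close> trans[OF \<psi>'(1)[symmetric] \<psi>'(2)]])
    then show ?thesis using eq by simp
  next
    fix C
    assume C: "C \<in> final_configs M" "\<psi> C \<noteq> 0"
      and \<psi>': "\<psi>' = (\<lambda>E. \<psi> C / complex_of_real (cmod (\<psi> C)) * ket C E)"
        "\<psi>' = (\<lambda>D. nonfinal_part M \<psi> D / complex_of_real (ell2_norm (nonfinal_part M \<psi>)))"
    from distinct[OF C] trans[OF \<psi>'(1)[symmetric] \<psi>'(2)] show ?thesis by (rule notE)
  next
    fix C
    assume C: "C \<in> final_configs M" "\<psi> C \<noteq> 0"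
      and \<psi>': "\<psi>' = (\<lambda>E. \<psi> C / complex_of_real (cmod (\<psi> C)) * ket C E)"
        "\<psi>' = (\<lambda>D. nonfinal_part M \<psi> D / complex_of_real (ell2_norm (nonfinal_part M \<psi>)))"
    from distinct[OF C] trans[OF \<psi>'(1)[symmetric] \<psi>'(2)] show ?thesis by (rule notE)
  qed simp
qed

lemma observation_prob_eq: "output_observation M \<psi> x \<psi>' p \<Longrightarrow> observation_prob M \<psi> \<psi>' = p"
  unfolding observation_prob_def using output_observation_unique by (intro the_equality) blast+

lemma observed_output_at_eq:
  "output_observation M (evolution M (R (\<tau> i))) x (R (Suc (\<tau> i))) p \<Longrightarrow> observed_output_at M \<tau> R i = x"
  unfolding observed_output_at_def using output_observation_unique by (intro the_equality) blast+

text \<open>Only one amplitude is nonzero and the nonfinal part is zero. Thus, once a value has been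
  observed, further observations repeat it with certainty and keep the phase.\<close>

lemma output_observation_final_ket:
  assumes "C \<in> final_configs M" "cmod c = 1"
  shows "output_observation M (\<lambda>D. c * ket C D) x \<psi>' p \<longleftrightarrow>
    x = Some (config_val M C) \<and> \<psi>' = (\<lambda>D. c * ket C D) \<and> p = 1"
proof -
  have "nonfinal_part M (\<lambda>D. c * ket C D) = (\<lambda>_. 0)"
    using assms by (auto simp: nonfinal_part_def ket_apply fun_eq_iff)
  then have *: "x = Some (config_val M C) \<and> \<psi>' = (\<lambda>D. c * ket C D) \<and> p = 1"
    if "output_observation M (\<lambda>D. c * ket C D) x \<psi>' p" for x \<psi>' p
    using that assms
    by (elim output_observation.cases) (auto simp: ket_apply fun_eq_iff split: if_splits)
  have "output_observation M (\<lambda>D. c * ket C D) (Some (config_val M C)) (\<lambda>D. c * ket C D) 1"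
    using output_observation.final[OF assms(1) refl, of "\<lambda>D. c * ket C D"] assms(2)
    by (force simp: ket_apply)
  then show ?thesis using * by blast
qed

lemma finite_run_prob_prefix:
  "finite_run_prob M \<tau> (run_prefix R k) =
     (\<Prod>h<k. if h \<in> range \<tau> then observation_prob M (evolution M (R h)) (R (Suc h)) else 1)"
  unfolding finite_run_prob_def run_prefix_def
  by (rule prod.cong) (auto simp: nth_append simp del: upt_Suc)

lemma finite_run_output_prefix:
  "\<tau> i < k \<Longrightarrow> finite_run_output M \<tau> i (run_prefix R k) = observed_output_at M \<tau> R i"
  unfolding finite_run_output_def run_prefix_def observed_output_at_def
  by (simp del: upt_Suc)

lemma finite_run_prob_Suc:
  "finite_run_prob M \<tau> (run_prefix R (Suc k)) = finite_run_prob M \<tau> (run_prefix R k) *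
     (if k \<in> range \<tau> then observation_prob M (evolution M (R k)) (R (Suc k)) else 1)"
  by (simp add: finite_run_prob_prefix)


section \<open>The run without an observed value\<close>

locale qtm_computation =
  fixes M :: "('a, 's) machine" and \<phi> :: "('a, 's) qconfig" and \<tau> :: "nat \<Rightarrow> nat"
  assumes qtm: "qtm M"
    and initial: "\<phi> \<in> unit_ell2 (init_configs M)"
    and schedule: "strict_mono \<tau>"
begin

abbreviation "U \<equiv> evolution M"
abbreviation "stage k \<equiv> (U ^^ k) \<phi>"

lemma pre: "pre_qtm M"
  using qtm by (simp add: qtm_def)

lemma unitary: "unitary_operator (configs M) U"
  using qtm by (simp add: qtm_def)

lemma final_subset_configs: "final_configs M \<subseteq> configs M"
  unfolding final_configs_def by (rule configs_in_state_subset)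

lemma U_ell2: "f \<in> ell2 (configs M) \<Longrightarrow> U f \<in> ell2 (configs M)"
  by (rule bounded_operator_ell2[OF unitary_bounded[OF unitary]])

lemma U_scale: "f \<in> ell2 (configs M) \<Longrightarrow> U (\<lambda>C. a * f C) = (\<lambda>C. a * U f C)"
  by (rule bounded_operator_scale[OF unitary_bounded[OF unitary]])

lemma U_ket_final: "C \<in> final_configs M \<Longrightarrow> U (ket C) = ket (advance C)"
  by (rule time_evolution_final[OF pre qtm_time_evolution[OF qtm]])

lemma U_advance: "f \<in> ell2 (configs M) \<Longrightarrow> C \<in> final_configs M \<Longrightarrow> U f (advance C) = f C"
  using unitary_ket_transport[OF unitary _ _ U_ket_final] final_subset_configs by blast

text \<open>No interference: amplitude that has reached a final configuration stays on the advanced final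
  configurations.\<close>

lemma U_cong_nonfinal:
  assumes f: "f \<in> ell2 (configs M)" and g: "g \<in> ell2 (configs M)"
    and eq: "\<And>C. C \<notin> final_configs M \<Longrightarrow> f C = g C"
    and D: "D \<notin> advance ` final_configs M"
  shows "U f D = U g D"
proof (cases "D \<in> configs M")
  case True
  \<comment> \<open>The difference lives on final configurations, whose kets are sent to advanced
    kets, all different from \<open>D\<close>.\<close>
  have "U (\<lambda>C. f C - g C) D = 0"
  proof (rule unitary_vanish[OF unitary ell2_diff[OF f g] True])
    fix C assume "f C - g C \<noteq> 0"
    then have "C \<in> final_configs M" using eq[of C] by auto
    then show "\<exists>E. U (ket C) = ket E \<and> E \<noteq> D" using U_ket_final D by blast
  qed
  then show ?thesis
    by (simp add: bounded_operator_diff[OF unitary_bounded[OF unitary] f g])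
next
  case False
  then show ?thesis using ell2_outside U_ell2 f g by metis
qed

section \<open>Amplitudes of the unobserved computation along counter chains\<close>

lemma initial_ell2: "\<phi> \<in> ell2 (configs M)"
  using initial ell2_mono[OF configs_in_state_subset[of M "init_state M"]]
  unfolding unit_ell2_def init_configs_def by blast

lemma initial_final: "C \<in> final_configs M \<Longrightarrow> \<phi> C = 0"
  using initial init_final_disjoint[OF qtm] ell2_outside[of \<phi> "init_configs M" C]
  unfolding unit_ell2_def by blast

lemma stage_ell2: "stage k \<in> ell2 (configs M)"
  by (induction k) (auto simp: initial_ell2 U_ell2)

lemma stage_norm: "ell2_norm (stage k) = 1"
proof (induction k)
  case 0
  then show ?case using initial by (simp add: unit_ell2_def)
next
  case (Suc k)
  then show ?case by (simp add: unitary_norm[OF unitary stage_ell2])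
qed

lemma advance_pow_final': "C \<in> final_configs M \<Longrightarrow> (advance ^^ m) C \<in> final_configs M"
  using advance_pow_final[OF pre] by blast

lemma stage_advance: "C \<in> final_configs M \<Longrightarrow> stage (h + m) ((advance ^^ m) C) = stage h C"
  by (induction m) (auto simp: U_advance stage_ell2 advance_pow_final')

text \<open>Going back \<open>h\<close> steps along the chain reaches a final configuration at time
  \<open>0\<close>, where the initial q-configuration has no amplitude. So a counter stays below the
  elapsed time.\<close>

lemma stage_advance_late:
  assumes "C \<in> final_configs M" "h \<le> m"
  shows "stage h ((advance ^^ m) C) = 0"
proof -
  have "stage h ((advance ^^ h) ((advance ^^ (m - h)) C)) = 0"
    using stage_advance[of "(advance ^^ (m - h)) C" 0 h] assms(1)
    by (simp add: advance_pow_final' initial_final)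
  moreover have "(advance ^^ h) ((advance ^^ (m - h)) C) = (advance ^^ m) C"
    using assms(2) funpow_add[of h "m - h" advance] by (metis comp_apply le_add_diff_inverse)
  ultimately show ?thesis by simp
qed

text \<open>The unnormalized run in which every output observation yields \<open>\<bottom>\<close>.\<close>

primrec chi :: "nat \<Rightarrow> ('a, 's) qconfig" where
  "chi 0 = \<phi>"
| "chi (Suc h) = (if h \<in> range \<tau> then nonfinal_part M (U (chi h)) else U (chi h))"

lemma nonfinal_part_ell2: "f \<in> ell2 (configs M) \<Longrightarrow> nonfinal_part M f \<in> ell2 (configs M)"
  by (rule ell2_dominated) (auto simp: nonfinal_part_def)

lemma chi_ell2: "chi h \<in> ell2 (configs M)"
  by (induction h) (auto simp: initial_ell2 U_ell2 nonfinal_part_ell2)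

lemma nonfinal_notin_advance: "C \<notin> final_configs M \<Longrightarrow> C \<notin> advance ` final_configs M"
  using advance_final(1)[OF pre] by blast

text \<open>An observation with outcome \<open>None\<close> removes final amplitude only, and by the
  absence of interference this never reaches a nonfinal configuration later.\<close>

lemma chi_nonfinal: "C \<notin> final_configs M \<Longrightarrow> chi h C = stage h C"
proof (induction h arbitrary: C)
  case (Suc h)
  have "U (chi h) C = U (stage h) C"
    by (rule U_cong_nonfinal[OF chi_ell2 stage_ell2 Suc.IH nonfinal_notin_advance[OF Suc.prems]])
  then show ?case using Suc.prems by (simp add: nonfinal_part_def)
qed simp

lemma entry_final: "D \<in> entry_configs M \<Longrightarrow> D \<in> final_configs M"
  using entry_subset_final by blast

text \<open>An entry configuration is not advanced, so its new amplitude depends only on the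
  nonfinal amplitudes, which \<open>chi\<close> shares with the unobserved computation.\<close>

lemma U_chi_entry:
  assumes "D \<in> entry_configs M"
  shows "U (chi h) D = stage (Suc h) D"
proof -
  have "D \<notin> advance ` final_configs M" using advance_notin_entry assms by (auto simp: image_iff)
  then show ?thesis using U_cong_nonfinal[OF chi_ell2 stage_ell2 chi_nonfinal] by simp
qed

text \<open>Amplitude entering in step \<open>g\<close> travels intact along its chain until an
  observation deletes it. The interval is closed: an observation scheduled at \<open>g\<close>
  already acts on the result of step \<open>g\<close>, and the one at \<open>g + m\<close> has acted
  too.\<close>

lemma chi_advance:
  assumes "D \<in> entry_configs M"
  shows "chi (Suc (g + m)) ((advance ^^ m) D) =
    (if {g..g + m} \<inter> range \<tau> = {} then stage (Suc g) D else 0)"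
proof (induction m)
  case 0
  then show ?case using assms U_chi_entry by (auto simp: nonfinal_part_def entry_final)
next
  case (Suc m)
  have final: "(advance ^^ m) D \<in> final_configs M" using advance_pow_final' entry_final assms by blast
  have "U (chi (Suc (g + m))) (advance ((advance ^^ m) D)) = chi (Suc (g + m)) ((advance ^^ m) D)"
    by (rule U_advance[OF chi_ell2 final])
  moreover have "advance ((advance ^^ m) D) \<in> final_configs M" by (rule advance_final(1)[OF pre final])
  moreover have "{g..Suc (g + m)} = insert (Suc (g + m)) {g..g + m}" by auto
  ultimately show ?case using Suc.IH
    by (simp add: nonfinal_part_def del: chi.simps add: chi.simps(2)[of "Suc (g + m)"])
qed

text \<open>This is the state after the step at time \<open>g + m\<close> but before a possible
  collapse at that time, hence the half-open interval.\<close>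

lemma U_chi_advance:
  assumes "D \<in> entry_configs M"
  shows "U (chi (g + m)) ((advance ^^ m) D) =
    (if {g..<g + m} \<inter> range \<tau> = {} then stage (Suc g) D else 0)"
proof (cases m)
  case 0
  then show ?thesis using U_chi_entry[OF assms] by simp
next
  case (Suc k)
  have "U (chi (Suc (g + k))) (advance ((advance ^^ k) D)) = chi (Suc (g + k)) ((advance ^^ k) D)"
    by (intro U_advance chi_ell2 advance_pow_final' entry_final assms)
  also have "\<dots> = (if {g..g + k} \<inter> range \<tau> = {} then stage (Suc g) D else 0)"
    by (rule chi_advance[OF assms])
  finally show ?thesis using Suc by (simp add: atLeastLessThanSuc_atLeastAtMost)
qed

lemma chi_advance_late: "C \<in> final_configs M \<Longrightarrow> h \<le> m \<Longrightarrow> chi h ((advance ^^ m) C) = 0"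
proof (induction h arbitrary: m)
  case 0
  then show ?case by (simp add: initial_final advance_pow_final')
next
  case (Suc h)
  then obtain k where k: "m = Suc k" "h \<le> k" by (cases m) auto
  have "U (chi h) (advance ((advance ^^ k) C)) = 0"
    using Suc k by (simp add: U_advance chi_ell2 advance_pow_final')
  then show ?case using k by (simp add: nonfinal_part_def)
qed

lemma U_chi_advance_late:
  assumes "D \<in> entry_configs M" "h < m"
  shows "U (chi h) ((advance ^^ m) D) = 0"
proof -
  obtain k where k: "m = Suc k" "h \<le> k" using assms(2) by (cases m) auto
  then show ?thesis
    using assms by (simp add: U_advance chi_ell2 advance_pow_final' entry_final chi_advance_late)
qed

section \<open>Normalization of the run with all outcomes \<open>None\<close>\<close>

abbreviation "weight h \<equiv> ell2_norm (chi h)"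

text \<open>Normalizing once by the current norm amounts to normalizing at each observation, because
  the factors telescope. If the norm is \<open>0\<close>, the result is the zero family.\<close>

definition nu :: "nat \<Rightarrow> ('a, 's) qconfig" where
  "nu h = (\<lambda>C. complex_of_real (1 / weight h) * chi h C)"

lemma weight_U: "ell2_norm (U (chi h)) = weight h"
  by (rule unitary_norm[OF unitary chi_ell2])

lemma weight_pos_U: "U (chi h) C \<noteq> 0 \<Longrightarrow> weight h > 0"
  using ell2_norm_pos[OF U_ell2[OF chi_ell2]] weight_U by metis

lemma weight_Suc_le: "weight (Suc h) \<le> weight h"
proof -
  have "weight (Suc h) \<le> ell2_norm (U (chi h))"
    by (rule ell2_norm_mono[OF U_ell2[OF chi_ell2]]) (simp add: nonfinal_part_def)
  then show ?thesis by (simp only: weight_U)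
qed

lemma weight_antimono: "g \<le> h \<Longrightarrow> weight h \<le> weight g"
  by (rule lift_Suc_antimono_le[of "\<lambda>h. weight h"]) (rule weight_Suc_le)

lemma weight_0: "weight 0 = 1"
  using stage_norm[of 0] by simp

lemma nu_0: "nu 0 = \<phi>"
  unfolding nu_def weight_0 by simp

lemma U_nu: "U (nu h) = (\<lambda>C. complex_of_real (1 / weight h) * U (chi h) C)"
  unfolding nu_def by (rule U_scale[OF chi_ell2])

lemma nu_unobserved: "h \<notin> range \<tau> \<Longrightarrow> nu (Suc h) = U (nu h)"
  unfolding U_nu by (simp add: nu_def weight_U)

lemma weight_unobserved: "h \<notin> range \<tau> \<Longrightarrow> weight (Suc h) = weight h"
  by (simp add: weight_U)

lemma nonfinal_part_U_nu:
  assumes "h \<in> range \<tau>"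
  shows "nonfinal_part M (U (nu h)) = (\<lambda>C. complex_of_real (1 / weight h) * chi (Suc h) C)"
  using assms by (auto simp: U_nu nonfinal_part_def)

lemma norm_nonfinal_part_U_nu:
  assumes "h \<in> range \<tau>"
  shows "ell2_norm (nonfinal_part M (U (nu h))) = weight (Suc h) / weight h"
  unfolding nonfinal_part_U_nu[OF assms] ell2_norm_scale
  by (simp add: ell2_norm_nonneg norm_divide del: chi.simps)

lemma nu_collapse:
  assumes "h \<in> range \<tau>" "weight h > 0"
  shows "(\<lambda>C. nonfinal_part M (U (nu h)) C / complex_of_real (ell2_norm (nonfinal_part M (U (nu h)))))
    = nu (Suc h)"
  unfolding norm_nonfinal_part_U_nu[OF assms(1)] unfolding nonfinal_part_U_nu[OF assms(1)]
  using assms(2) by (simp add: nu_def del: chi.simps)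

text \<open>The outcome \<open>None\<close> costs the squared ratio of consecutive weights, a form
  that telescopes in products.\<close>

lemma observation_nonfinal:
  assumes "h \<in> range \<tau>" "weight (Suc h) > 0"
  shows "output_observation M (U (nu h)) None (nu (Suc h)) ((weight (Suc h) / weight h)\<^sup>2)"
proof -
  have h: "weight h > 0" using assms(2) weight_Suc_le[of h] by linarith
  have "nonfinal_part M (U (nu h)) \<noteq> (\<lambda>_. 0)"
  proof
    assume "nonfinal_part M (U (nu h)) = (\<lambda>_. 0)"
    then have "ell2_norm (nonfinal_part M (U (nu h))) = 0" by (simp add: ell2_norm_def)
    then show False using assms h norm_nonfinal_part_U_nu[OF assms(1)] by simp
  qed
  from output_observation.nonfinal[OF this] show ?thesis
    by (simp only: nu_collapse[OF assms(1) h]) (simp only: norm_nonfinal_part_U_nu[OF assms(1)])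
qed

text \<open>The final outcome is expressed through \<open>chi\<close> instead of \<open>nu\<close>,
  since the positive normalization drops out of the phase.\<close>

lemma observation_nu_cases:
  assumes "h \<in> range \<tau>" "output_observation M (U (nu h)) x \<psi>' p"
  obtains (none) "x = None" "\<psi>' = nu (Suc h)"
  | (some) C where "C \<in> final_configs M" "U (chi h) C \<noteq> 0" "weight h > 0"
      "x = Some (config_val M C)" "\<psi>' = (\<lambda>D. sgn (U (chi h) C) * ket C D)"
proof -
  from assms(2) consider
    C where "C \<in> final_configs M" "U (nu h) C \<noteq> 0" "x = Some (config_val M C)"
      "\<psi>' = (\<lambda>D. U (nu h) C / complex_of_real (cmod (U (nu h) C)) * ket C D)"
  | "nonfinal_part M (U (nu h)) \<noteq> (\<lambda>_. 0)" "x = None"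
    "\<psi>' = (\<lambda>C. nonfinal_part M (U (nu h)) C / complex_of_real (ell2_norm (nonfinal_part M (U (nu h)))))"
    by (elim output_observation.cases) blast+
  then show ?thesis
  proof cases
    case (1 C)
    have "U (chi h) C \<noteq> 0" "weight h > 0"
      using 1(2) ell2_norm_nonneg[of "chi h"] by (auto simp: U_nu intro: le_neq_trans)
    moreover have "U (nu h) C / complex_of_real (cmod (U (nu h) C)) = sgn (U (chi h) C)"
      using \<open>weight h > 0\<close> by (simp add: U_nu sgn_eq norm_mult norm_divide)
    ultimately show ?thesis using some 1 by simp
  next
    case 2
    then obtain C where "U (nu h) C \<noteq> 0" by (auto simp: nonfinal_part_def fun_eq_iff split: if_splits)
    then have "weight h > 0" using ell2_norm_nonneg[of "chi h"] by (auto simp: U_nu intro: le_neq_trans)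
    then show ?thesis using none 2 nu_collapse[OF assms(1)] by simp
  qed
qed


section \<open>Runs with an observed value\<close>

definition next_obs :: "nat \<Rightarrow> nat" where
  "next_obs h = (LEAST t. h \<le> t \<and> t \<in> range \<tau>)"

lemma next_obs: "h \<le> next_obs h" "next_obs h \<in> range \<tau>"
proof -
  \<comment> \<open>A strictly increasing sequence of naturals dominates its index, so
    \<open>\<tau> h\<close> shows that an observation follows \<open>h\<close>.\<close>
  have "h \<le> \<tau> h \<and> \<tau> h \<in> range \<tau>" using schedule by (simp add: seq_suble)
  then have "h \<le> next_obs h \<and> next_obs h \<in> range \<tau>"
    unfolding next_obs_def by (rule LeastI)
  then show "h \<le> next_obs h" "next_obs h \<in> range \<tau>" by auto
qed

lemma next_obs_le_iff: "t \<in> range \<tau> \<Longrightarrow> next_obs h \<le> t \<longleftrightarrow> h \<le> t"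
  using next_obs(1)[of h] Least_le[of "\<lambda>t. h \<le> t \<and> t \<in> range \<tau>" t]
  unfolding next_obs_def by auto

lemma next_obs_eqI:
  assumes "h \<le> t" "t \<in> range \<tau>" "{h..<t} \<inter> range \<tau> = {}"
  shows "next_obs h = t"
proof (rule antisym)
  show "next_obs h \<le> t" using assms next_obs_le_iff by blast
  show "t \<le> next_obs h"
  proof (rule ccontr)
    assume "\<not> t \<le> next_obs h"
    then have "next_obs h \<in> {h..<t} \<inter> range \<tau>" using next_obs[of h] by simp
    then show False using assms(3) by blast
  qed
qed

lemma next_obs_gap: "{h..<next_obs h} \<inter> range \<tau> = {}"
  using next_obs_le_iff[of _ h] by fastforce

text \<open>\<open>(h, D)\<close> is an arrival if amplitude enters the final configurations through \<open>D\<close> in the step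
  from time \<open>h\<close> to time \<open>h + 1\<close>; \<open>collapse_run h D\<close> is the run in which the next output observation
  finds it.\<close>

definition arrivals :: "(nat \<times> ('a, 's) config) set" where
  "arrivals = {(h, D). D \<in> entry_configs M \<and> stage (Suc h) D \<noteq> 0}"

definition collapse_run :: "nat \<Rightarrow> ('a, 's) config \<Rightarrow> nat \<Rightarrow> ('a, 's) qconfig" where
  "collapse_run h D g = (if g \<le> next_obs h then nu g
     else (\<lambda>C. sgn (stage (Suc h) D) * ket ((advance ^^ (g - Suc h)) D) C))"

text \<open>Applied at unobserved times too: for an arrival, the positive weights before its
  collapse are equal across such a step, which gives factor \<open>1\<close>.\<close>

definition step_prob :: "nat \<Rightarrow> ('a, 's) config \<Rightarrow> nat \<Rightarrow> real" where
  "step_prob h D g = (if g < next_obs h then (weight (Suc g) / weight g)\<^sup>2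
     else if g = next_obs h then (cmod (stage (Suc h) D) / weight g)\<^sup>2 else 1)"

context
  fixes h :: nat and D :: "('a, 's) config"
  assumes arrival: "(h, D) \<in> arrivals"
begin

lemma arrival_entry: "D \<in> entry_configs M" and arrival_amplitude: "stage (Suc h) D \<noteq> 0"
  using arrival by (auto simp: arrivals_def)

lemma arrival_final: "(advance ^^ m) D \<in> final_configs M"
  by (rule advance_pow_final'[OF entry_final[OF arrival_entry]])

lemma arrival_val: "config_val M ((advance ^^ m) D) = config_val M D"
  using advance_pow_final[OF pre entry_final[OF arrival_entry]] by blast

text \<open>No observation falls in between, so the entering amplitude is still intact just before
  the collapse.\<close>

lemma arrival_at_next_obs: "U (chi (next_obs h)) ((advance ^^ (next_obs h - h)) D) = stage (Suc h) D"
  using U_chi_advance[OF arrival_entry, of h "next_obs h - h"] next_obs(1)[of h] next_obs_gap[of h]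
  by simp

text \<open>A surviving nonzero amplitude makes the weight positive at the collapse time, and
  weights only decrease. All earlier divisions by weights are therefore legitimate.\<close>

lemma arrival_weight_pos: "g \<le> next_obs h \<Longrightarrow> weight g > 0"
proof -
  assume "g \<le> next_obs h"
  then have "weight (next_obs h) \<le> weight g" by (rule weight_antimono)
  moreover have "weight (next_obs h) > 0"
    using weight_pos_U arrival_at_next_obs arrival_amplitude by metis
  ultimately show "weight g > 0" by linarith
qed

text \<open>At time \<open>g\<close> the arrival has advanced \<open>g - Suc h\<close> times,
  because \<open>D\<close> is occupied at time \<open>Suc h\<close>; applying \<open>U\<close>
  advances it once more.\<close>

lemma U_collapse_run_late:
  assumes "next_obs h < g"
  shows "U (collapse_run h D g) = (\<lambda>C. sgn (stage (Suc h) D) * ket ((advance ^^ (g - h)) D) C)"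
proof -
  have "g - h = Suc (g - Suc h)" using assms next_obs(1)[of h] by simp
  moreover have "(advance ^^ (g - Suc h)) D \<in> configs M" using arrival_final final_subset_configs by blast
  ultimately show ?thesis
    using assms U_scale[OF ket_in_ell2] U_ket_final[OF arrival_final] by (simp add: collapse_run_def)
qed

lemma collapse_run_unobserved:
  assumes "g \<notin> range \<tau>"
  shows "collapse_run h D (Suc g) = U (collapse_run h D g)"
proof (cases "g \<le> next_obs h")
  case True
  then have "g < next_obs h" using assms next_obs(2)[of h] by (metis le_neq_implies_less)
  then show ?thesis using assms by (simp add: collapse_run_def nu_unobserved)
next
  case False
  then show ?thesis using U_collapse_run_late[of g] by (simp add: collapse_run_def)
qed

lemma collapse_run_observed:
  assumes "g \<in> range \<tau>"
  shows "output_observation M (U (collapse_run h D g)) (if g < next_obs h then None else Some (config_val M D))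
    (collapse_run h D (Suc g)) (step_prob h D g)"
proof -
  consider "g < next_obs h" | "g = next_obs h" | "next_obs h < g" by linarith
  then show ?thesis
  proof cases
    case 1
    then show ?thesis
      using observation_nonfinal[OF assms arrival_weight_pos] by (simp add: collapse_run_def step_prob_def del: chi.simps)
  next
    case 2
    \<comment> \<open>The position of the arrival just before the collapse: one advance for each
      step since its entry.\<close>
    define C where "C = (advance ^^ (g - h)) D"
    have C: "C \<in> final_configs M" "config_val M C = config_val M D"
      unfolding C_def by (rule arrival_final arrival_val)+
    have w: "weight g > 0" using arrival_weight_pos 2 by simp
    have amp: "U (nu g) C = complex_of_real (1 / weight g) * stage (Suc h) D"
      using arrival_at_next_obs by (simp add: U_nu C_def 2)
    have "U (nu g) C \<noteq> 0" using w arrival_amplitude by (simp add: amp)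
    with C have obs: "output_observation M (U (nu g)) (Some (config_val M D))
      (\<lambda>E. U (nu g) C / complex_of_real (cmod (U (nu g) C)) * ket C E) ((cmod (U (nu g) C))\<^sup>2)"
      by (rule output_observation.final)
    have phase: "U (nu g) C / complex_of_real (cmod (U (nu g) C)) = sgn (stage (Suc h) D)"
      using w by (simp add: amp sgn_eq norm_mult norm_divide)
    have modulus: "cmod (U (nu g) C) = cmod (stage (Suc h) D) / weight g"
      using w by (simp add: amp norm_mult norm_divide)
    show ?thesis
      using obs[unfolded phase, unfolded modulus] 2 by (simp add: collapse_run_def step_prob_def C_def)
  next
    case 3
    have "cmod (sgn (stage (Suc h) D)) = 1" using arrival_amplitude by (simp add: norm_sgn)
    from output_observation_final_ket[OF arrival_final this, of "g - h" "Some (config_val M D)"]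
    show ?thesis using 3 U_collapse_run_late[OF 3] by (simp add: collapse_run_def step_prob_def arrival_val)
  qed
qed

lemma collapse_run_in_observed_runs: "collapse_run h D \<in> observed_runs M \<tau> \<phi>"
proof -
  have "collapse_run h D 0 = \<phi>" by (simp add: collapse_run_def nu_0)
  then show ?thesis
    unfolding observed_runs_def using collapse_run_observed collapse_run_unobserved by auto
qed

lemma observed_output_at_collapse_run:
  "observed_output_at M \<tau> (collapse_run h D) i = (if \<tau> i < h then None else Some (config_val M D))"
proof -
  have "\<tau> i < next_obs h \<longleftrightarrow> \<tau> i < h" using next_obs_le_iff[of "\<tau> i" h] by (simp add: not_le[symmetric])
  then show ?thesis
    using observed_output_at_eq[where M = M and \<tau> = \<tau> and i = i and R = "collapse_run h D", OF collapse_run_observed[of "\<tau> i"]] by simp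
qed

text \<open>The squared weight ratios telescope to the current squared weight, which the denominator
  of the collapse probability then cancels; all later factors are \<open>1\<close>.\<close>

lemma finite_run_prob_collapse_run:
  "finite_run_prob M \<tau> (run_prefix (collapse_run h D) k) =
    (if k \<le> next_obs h then (weight k)\<^sup>2 else (cmod (stage (Suc h) D))\<^sup>2)"
proof (induction k)
  case 0
  then show ?case using weight_0 by (simp add: finite_run_prob_prefix)
next
  case (Suc k)
  have step: "(if k \<in> range \<tau>
      then observation_prob M (U (collapse_run h D k)) (collapse_run h D (Suc k)) else 1) = step_prob h D k"
  proof (cases "k \<in> range \<tau>")
    case True
    then show ?thesis using observation_prob_eq[OF collapse_run_observed] by simp
  next
    case False
    then have "k \<noteq> next_obs h" using next_obs(2)[of h] by metis
    moreover have "weight k \<noteq> 0" if "k < next_obs h" using arrival_weight_pos[of k] that by simp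
    ultimately show ?thesis
      using False weight_unobserved[of k] by (simp add: step_prob_def del: chi.simps)
  qed
  show ?case
    unfolding finite_run_prob_Suc Suc.IH step
    using arrival_weight_pos[of k] by (auto simp: step_prob_def power_divide simp del: chi.simps)
qed

lemma run_prob_collapse_run: "run_prob M \<tau> (collapse_run h D) = (cmod (stage (Suc h) D))\<^sup>2"
  unfolding run_prob_def
proof (rule limI, rule tendsto_eventually)
  show "\<forall>\<^sub>F k in sequentially.
      finite_run_prob M \<tau> (run_prefix (collapse_run h D) k) = (cmod (stage (Suc h) D))\<^sup>2"
    using eventually_gt_at_top[of "next_obs h"]
    by eventually_elim (simp add: finite_run_prob_collapse_run)
qed

end

text \<open>After both collapses each run is a phase times one ket, so equality identifies the two
  configurations, and hence their entry points and counters. Since \<open>h\<close> and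
  \<open>h'\<close> are below \<open>k\<close>, the truncated subtraction loses nothing. A single
  time suffices, which serves finite prefixes and infinite runs alike.\<close>

lemma collapse_run_inj:
  assumes "(h, D) \<in> arrivals" "(h', D') \<in> arrivals" "h < k" "h' < k" "next_obs h < k" "next_obs h' < k"
    and eq: "collapse_run h D k = collapse_run h' D' k"
  shows "(h, D) = (h', D')"
proof -
  have "sgn (stage (Suc h) D) * ket ((advance ^^ (k - Suc h)) D) C =
      sgn (stage (Suc h') D') * ket ((advance ^^ (k - Suc h')) D') C" for C
    using fun_cong[OF eq, of C] assms by (simp add: collapse_run_def)
  from this[of "(advance ^^ (k - Suc h)) D"]
  have "(advance ^^ (k - Suc h)) D = (advance ^^ (k - Suc h')) D'"
    using arrival_amplitude[OF assms(1)] by (auto simp: ket_apply sgn_zero_iff split: if_splits)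
  then show ?thesis
    using advance_pow_eq_iff[OF arrival_entry[OF assms(1)] arrival_entry[OF assms(2)]] assms(3,4) by auto
qed

text \<open>The first departure from \<open>nu\<close> must be an observation finding a final
  configuration. Its counter identifies the arrival, and from then on the run is
  deterministic.\<close>

lemma observed_runs_cases:
  assumes R: "R \<in> observed_runs M \<tau> \<phi>"
  obtains (nonfinal) "\<And>g. R g = nu g" | (collapse) h D where "(h, D) \<in> arrivals" "R = collapse_run h D"
proof (cases "\<forall>g. R g = nu g")
  case True
  then show ?thesis using nonfinal by blast
next
  case False
  define g where "g = (LEAST g. R g \<noteq> nu g)"
  have g: "R g \<noteq> nu g" "\<And>f. f < g \<Longrightarrow> R f = nu f"
    using False LeastI_ex[of "\<lambda>g. R g \<noteq> nu g"] not_less_Least[of _ "\<lambda>g. R g \<noteq> nu g"]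
    unfolding g_def by blast+
  have R0: "R 0 = nu 0" using R by (simp add: observed_runs_def nu_0)
  have unobs: "f \<notin> range \<tau> \<Longrightarrow> R (Suc f) = U (R f)" for f
    using R unfolding observed_runs_def by (auto split: if_splits)
  have obs: "f \<in> range \<tau> \<Longrightarrow> \<exists>x p. output_observation M (U (R f)) x (R (Suc f)) p" for f
    using R unfolding observed_runs_def by (auto split: if_splits)
  obtain t where t: "g = Suc t" using g(1) R0 by (cases g) auto
  have Rt: "R f = nu f" if "f \<le> t" for f using g(2) that t by simp
  have "t \<in> range \<tau>"
  proof (rule ccontr)
    assume "t \<notin> range \<tau>"
    then have "R g = nu g" using unobs Rt[of t] nu_unobserved t by simp
    then show False using g(1) by blast
  qed
  then obtain x p where "output_observation M (U (nu t)) x (R (Suc t)) p" using obs[of t] unfolding Rt[of t, OF order.refl] by blast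
  with \<open>t \<in> range \<tau>\<close> obtain C where C: "C \<in> final_configs M" "U (chi t) C \<noteq> 0"
    and RSuc: "R (Suc t) = (\<lambda>E. sgn (U (chi t) C) * ket C E)"
    using g(1) t by (elim observation_nu_cases) auto
  obtain m D where D: "D \<in> entry_configs M" and CD: "C = (advance ^^ m) D"
    using final_configs_cases[OF pre C(1)] by blast
  \<comment> \<open>A counter cannot exceed the number of completed steps before this one.\<close>
  have "m \<le> t" using U_chi_advance_late[OF D, of t m] C(2) CD by (metis not_le)
  \<comment> \<open>\<open>C\<close> is occupied at time \<open>Suc t\<close> with counter
    \<open>m\<close>, so its entry point was occupied at time
    \<open>Suc t - m = Suc h\<close>.\<close>
  define h where "h = t - m"
  have h: "t = h + m" using \<open>m \<le> t\<close> by (simp add: h_def)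
  \<comment> \<open>Nonzero amplitude excludes the deleted case, so no observation occurred since
    the entry.\<close>
  have gap: "{h..<t} \<inter> range \<tau> = {}" and amp: "U (chi t) C = stage (Suc h) D"
    using U_chi_advance[OF D, of h m] C(2) unfolding CD h by (auto split: if_splits)
  have arr: "(h, D) \<in> arrivals" using D C(2) amp by (simp add: arrivals_def)
  have next_t: "next_obs h = t" using gap \<open>t \<in> range \<tau>\<close> h by (intro next_obs_eqI) auto
  have late: "R (Suc t + j) = collapse_run h D (Suc t + j)" for j
  proof (induction j)
    case 0
    have "R (Suc t) = (\<lambda>E. sgn (stage (Suc h) D) * ket ((advance ^^ m) D) E)"
      unfolding RSuc amp unfolding CD ..
    then show ?case using next_t h by (simp add: collapse_run_def)
  next
    case (Suc j)
    let ?f = "Suc t + j"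
    show ?case
    proof (cases "?f \<in> range \<tau>")
      case False
      then show ?thesis using unobs[OF False] collapse_run_unobserved[OF arr False] Suc.IH by simp
    next
      case True
      have f: "next_obs h < ?f" using next_t by simp
      have c: "cmod (sgn (stage (Suc h) D)) = 1"
        using arrival_amplitude[OF arr] by (simp add: norm_sgn)
      obtain x p where "output_observation M (U (R ?f)) x (R (Suc ?f)) p" using obs[OF True] by blast
      then have "R (Suc ?f) = (\<lambda>C. sgn (stage (Suc h) D) * ket ((advance ^^ (?f - h)) D) C)"
        unfolding Suc.IH U_collapse_run_late[OF arr f]
          output_observation_final_ket[OF arrival_final[OF arr] c] by blast
      then show ?thesis using next_t by (simp add: collapse_run_def)
    qed
  qed
  have "R f = collapse_run h D f" for f
  proof (cases "f \<le> t")
    case True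
    then show ?thesis using Rt next_t by (simp add: collapse_run_def)
  next
    case False
    then show ?thesis using late[of "f - Suc t"] by simp
  qed
  then show ?thesis using collapse arr by blast
qed

lemma observed_output_at_nu:
  assumes R: "R \<in> observed_runs M \<tau> \<phi>" and nu: "\<And>g. R g = nu g"
  shows "observed_output_at M \<tau> R i = None"
proof -
  have "\<exists>x p. output_observation M (U (R (\<tau> i))) x (R (Suc (\<tau> i))) p"
    using R unfolding observed_runs_def by (auto dest: spec[of _ "\<tau> i"])
  then obtain x p where obs: "output_observation M (U (R (\<tau> i))) x (R (Suc (\<tau> i))) p" by blast
  have "x = None"
    using rangeI obs[unfolded nu]
  proof (cases rule: observation_nu_cases)
    case (some C)
    \<comment> \<open>Right after an observation \<open>nu\<close> vanishes on final configurations,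
      which contradicts a collapse onto \<open>C\<close>.\<close>
    have "nu (Suc (\<tau> i)) C = 0" using some(1) by (simp add: nu_def nonfinal_part_def)
    then show ?thesis using fun_cong[OF some(5), of C] some(2) by (simp add: ket_apply sgn_zero_iff)
  qed
  then show ?thesis using observed_output_at_eq[where M = M and \<tau> = \<tau> and i = i and R = R, OF obs] by simp
qed

lemma observed_runs_with_output:
  assumes "R \<in> observed_runs M \<tau> \<phi>" "observed_output_at M \<tau> R i = Some n"
  obtains h D where "(h, D) \<in> arrivals" "config_val M D = n" "h \<le> \<tau> i" "R = collapse_run h D"
  using assms(1)
proof (cases rule: observed_runs_cases)
  case nonfinal
  then show ?thesis using observed_output_at_nu[OF assms(1)] assms(2) by simp
next
  case (collapse h D)
  then show ?thesis
    using that assms(2) observed_output_at_collapse_run[OF collapse(1)] by (auto split: if_splits)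
qed


section \<open>Summation over arrivals\<close>

abbreviation "arrival_prob x \<equiv> (cmod (stage (Suc (fst x)) (snd x)))\<^sup>2"

definition val_arrivals :: "nat \<Rightarrow> (nat \<times> ('a, 's) config) set" where
  "val_arrivals n = {(h, D) \<in> arrivals. config_val M D = n}"

text \<open>Advancing each arrival up to time \<open>k\<close> preserves amplitude and value. This
  is an injection into the final configurations of value \<open>n\<close> whose image contains every
  one with nonzero amplitude, so the sum can be reindexed.\<close>

lemma value_prob_has_sum:
  "(arrival_prob has_sum value_prob M (stage k) n) {x \<in> val_arrivals n. fst x < k}"
proof -
  let ?A = "{x \<in> val_arrivals n. fst x < k}" and ?f = "\<lambda>(h, D). (advance ^^ (k - Suc h)) D"
  let ?g = "\<lambda>C. (cmod (stage k C))\<^sup>2"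
  have amp: "stage k (?f x) = stage (Suc (fst x)) (snd x)" if "x \<in> ?A" for x
  proof -
    obtain h D where x: "x = (h, D)" by fastforce
    have "D \<in> entry_configs M" "h < k" using that by (auto simp: x val_arrivals_def arrivals_def)
    then show ?thesis using stage_advance[OF entry_final, of D "Suc h" "k - Suc h"] by (simp add: x)
  qed
  have inj: "inj_on ?f ?A"
  proof (rule inj_onI, clarify)
    fix h D h' D'
    assume "(h, D) \<in> val_arrivals n" "fst (h, D) < k" "(h', D') \<in> val_arrivals n" "fst (h', D') < k"
      and eq: "(advance ^^ (k - Suc h)) D = (advance ^^ (k - Suc h')) D'"
    then have "D \<in> entry_configs M" "D' \<in> entry_configs M" "h < k" "h' < k"
      by (auto simp: val_arrivals_def arrivals_def)
    then show "h = h' \<and> D = D'" using eq advance_pow_eq_iff[of D M D'] by auto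
  qed
  have sub: "?f ` ?A \<subseteq> {C \<in> final_configs M. config_val M C = n}"
    using arrival_final arrival_val by (auto simp: val_arrivals_def)
  have zero: "stage k C = 0" if C: "C \<in> final_configs M" "config_val M C = n" "C \<notin> ?f ` ?A" for C
  proof (rule ccontr)
    assume nz: "stage k C \<noteq> 0"
    obtain m D where D: "D \<in> entry_configs M" and CD: "C = (advance ^^ m) D"
      using final_configs_cases[OF pre C(1)] by blast
    have "m < k" using stage_advance_late[OF entry_final[OF D], of k m] nz CD by (metis not_le)
    \<comment> \<open>Traces \<open>C\<close> back by its counter \<open>m\<close> to the step in
      which its amplitude entered.\<close>
    define h where "h = k - Suc m"
    have k: "k = Suc h + m" using \<open>m < k\<close> by (simp add: h_def)
    have "stage (Suc h) D \<noteq> 0" using stage_advance[OF entry_final[OF D], of "Suc h" m] nz unfolding CD k by simp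
    then have arr: "(h, D) \<in> arrivals" using D by (simp add: arrivals_def)
    then have "(h, D) \<in> ?A" using C(2) arrival_val[OF arr] k by (simp add: val_arrivals_def CD)
    moreover have "C = ?f (h, D)" using k by (simp add: CD)
    ultimately show False using C(3) by blast
  qed
  have "(?g has_sum value_prob M (stage k) n) (?f ` ?A) \<longleftrightarrow>
      (?g has_sum value_prob M (stage k) n) {C \<in> final_configs M. config_val M C = n}"
  proof (rule has_sum_cong_neutral)
    fix C assume "C \<in> {C \<in> final_configs M. config_val M C = n} - ?f ` ?A"
    then have "stage k C = 0" by (intro zero) simp_all
    then show "?g C = 0" by simp
  next
    fix C assume "C \<in> ?f ` ?A - {C \<in> final_configs M. config_val M C = n}"
    then show "?g C = 0" by (simp only: sub[THEN iffD2[OF Diff_eq_empty_iff]] empty_iff)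
  qed (rule refl)
  moreover have "(?g has_sum value_prob M (stage k) n) {C \<in> final_configs M. config_val M C = n}"
    unfolding value_prob_def by (intro has_sum_infsum ell2_summable[OF stage_ell2])
  ultimately have "((?g \<circ> ?f) has_sum value_prob M (stage k) n) ?A"
    using has_sum_reindex[OF inj] by blast
  then show ?thesis
    by (subst has_sum_cong[where g = "?g \<circ> ?f"]) (simp_all add: amp)
qed

section \<open>Convergence to the total weight of the arrivals\<close>

lemma value_prob_le_1: "value_prob M (stage k) n \<le> 1"
  using infsum_subset_le_ell2_norm[OF stage_ell2] stage_norm unfolding value_prob_def by simp

text \<open>Beyond its latest entry time a finite set of arrivals is counted completely. This yields
  both the uniform bound for summability and the lower estimate for the limit.\<close>

lemma finite_val_arrivals_le:
  assumes "finite X" "X \<subseteq> val_arrivals n"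
  obtains K where "\<And>k. k \<ge> K \<Longrightarrow> sum arrival_prob X \<le> value_prob M (stage k) n"
proof
  fix k assume k: "k \<ge> Suc (Max (fst ` X))"
  have "fst x < k" if "x \<in> X" for x
  proof -
    have "fst x \<le> Max (fst ` X)" using assms(1) that by (intro Max_ge) auto
    then show ?thesis using k by linarith
  qed
  then have "X \<subseteq> {x \<in> val_arrivals n. fst x < k}" using assms(2) by blast
  then show "sum arrival_prob X \<le> value_prob M (stage k) n"
    by (intro has_sum_mono2[OF has_sum_finite[OF assms(1)] value_prob_has_sum]) auto
qed

lemma arrival_prob_summable: "arrival_prob summable_on val_arrivals n"
proof (rule nonneg_bdd_above_summable_on)
  show "bdd_above (sum arrival_prob ` {X. X \<subseteq> val_arrivals n \<and> finite X})"
  proof (rule bdd_aboveI2)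
    fix X assume "X \<in> {X. X \<subseteq> val_arrivals n \<and> finite X}"
    then obtain K where "\<And>k. k \<ge> K \<Longrightarrow> sum arrival_prob X \<le> value_prob M (stage k) n"
      using finite_val_arrivals_le by blast
    then show "sum arrival_prob X \<le> 1" using value_prob_le_1[of K n] by (meson order.refl order.trans)
  qed
qed simp

text \<open>Every term sums over a subset of the arrivals and so stays below the total, while finite
  subsets whose sums approach the total are eventually included.\<close>

lemma value_prob_tendsto: "(\<lambda>k. value_prob M (stage k) n) \<longlonglongrightarrow> infsum arrival_prob (val_arrivals n)"
proof (rule order_tendstoI)
  let ?p = "infsum arrival_prob (val_arrivals n)"
  have le: "value_prob M (stage k) n \<le> ?p" for k
    by (rule has_sum_mono2[OF value_prob_has_sum has_sum_infsum[OF arrival_prob_summable]]) auto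
  show "\<forall>\<^sub>F k in sequentially. value_prob M (stage k) n < a" if "?p < a" for a
    using le_less_trans[OF le that] by (intro always_eventually allI)
  show "\<forall>\<^sub>F k in sequentially. a < value_prob M (stage k) n" if "a < ?p" for a
  proof -
    have "(sum arrival_prob \<longlongrightarrow> ?p) (finite_subsets_at_top (val_arrivals n))"
      using has_sum_infsum[OF arrival_prob_summable] by (simp add: has_sum_def)
    from order_tendstoD(1)[OF this that]
    obtain X where X: "finite X" "X \<subseteq> val_arrivals n" "a < sum arrival_prob X"
      unfolding eventually_finite_subsets_at_top by blast
    then obtain K where "\<And>k. k \<ge> K \<Longrightarrow> sum arrival_prob X \<le> value_prob M (stage k) n"
      using finite_val_arrivals_le by blast
    then show ?thesis using X(3) unfolding eventually_sequentially by (meson less_le_trans)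
  qed
qed

lemma finite_observed_runs_with_output:
  "{rs \<in> finite_observed_runs M \<tau> \<phi> (\<tau> i + 1). finite_run_output M \<tau> i rs = Some n} =
    (\<lambda>(h, D). run_prefix (collapse_run h D) (\<tau> i + 1)) ` {x \<in> val_arrivals n. fst x < \<tau> i + 1}"
  (is "?L = ?F ` ?A")
proof
  show "?L \<subseteq> ?F ` ?A"
  proof
    fix rs assume "rs \<in> ?L"
    then obtain R where R: "R \<in> observed_runs M \<tau> \<phi>" "rs = run_prefix R (\<tau> i + 1)"
      "observed_output_at M \<tau> R i = Some n"
      by (auto simp: finite_observed_runs_def finite_run_output_prefix)
    obtain h D where "(h, D) \<in> arrivals" "config_val M D = n" "h \<le> \<tau> i" "R = collapse_run h D"
      by (rule observed_runs_with_output[OF R(1,3)])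
    then have "(h, D) \<in> ?A" "rs = ?F (h, D)" using R(2) by (auto simp: val_arrivals_def)
    then show "rs \<in> ?F ` ?A" by blast
  qed
  show "?F ` ?A \<subseteq> ?L"
    by (auto simp: val_arrivals_def finite_observed_runs_def finite_run_output_prefix
        collapse_run_in_observed_runs observed_output_at_collapse_run)
qed

lemma finite_runs_has_sum:
  "(finite_run_prob M \<tau> has_sum value_prob M (stage (\<tau> i + 1)) n)
    {rs \<in> finite_observed_runs M \<tau> \<phi> (\<tau> i + 1). finite_run_output M \<tau> i rs = Some n}"
proof -
  let ?A = "{x \<in> val_arrivals n. fst x < \<tau> i + 1}"
    and ?F = "\<lambda>(h, D). run_prefix (collapse_run h D) (\<tau> i + 1)"
  \<comment> \<open>As \<open>\<tau> i\<close> is itself an observation time, every arrival with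
    \<open>h \<le> \<tau> i\<close> has collapsed by the end of the prefix and carries its full
    weight.\<close>
  have next_le: "next_obs h < \<tau> i + 1" if "h < \<tau> i + 1" for h
    using that next_obs_le_iff[of "\<tau> i" h] by auto
  have inj: "inj_on ?F ?A"
  proof (rule inj_onI, clarify)
    fix h D h' D'
    assume A: "(h, D) \<in> val_arrivals n" "fst (h, D) < \<tau> i + 1" "(h', D') \<in> val_arrivals n" "fst (h', D') < \<tau> i + 1"
      and "run_prefix (collapse_run h D) (\<tau> i + 1) = run_prefix (collapse_run h' D') (\<tau> i + 1)"
    then have "collapse_run h D (\<tau> i + 1) = collapse_run h' D' (\<tau> i + 1)"
      by (simp add: run_prefix_def)
    then have "(h, D) = (h', D')"
      using A next_le by (intro collapse_run_inj[of h D h' D' "\<tau> i + 1"]) (auto simp: val_arrivals_def)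
    then show "h = h' \<and> D = D'" by simp
  qed
  have prob: "(finite_run_prob M \<tau> \<circ> ?F) x = arrival_prob x" if x: "x \<in> ?A" for x
  proof -
    obtain h D where hD: "x = (h, D)" by fastforce
    have "(h, D) \<in> arrivals" "h < \<tau> i + 1" using x by (auto simp: hD val_arrivals_def)
    then show ?thesis
      using finite_run_prob_collapse_run[of h D "\<tau> i + 1"] next_le[of h] by (simp add: hD)
  qed
  show ?thesis
    unfolding finite_observed_runs_with_output
    by (rule iffD2[OF has_sum_reindex[OF inj]], rule iffD2[OF has_sum_cong[OF prob]])
      (assumption, rule value_prob_has_sum)
qed

lemma runs_has_sum:
  "(run_prob M \<tau> has_sum infsum arrival_prob (val_arrivals n))
    {R \<in> observed_runs M \<tau> \<phi>. run_has_output M \<tau> R (Some n)}"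
proof -
  let ?F = "\<lambda>(h, D). collapse_run h D"
  have image: "{R \<in> observed_runs M \<tau> \<phi>. run_has_output M \<tau> R (Some n)} = ?F ` val_arrivals n" (is "?L = _")
  proof
    show "?L \<subseteq> ?F ` val_arrivals n"
    proof
      fix R assume "R \<in> ?L"
      then obtain i where R: "R \<in> observed_runs M \<tau> \<phi>" "observed_output_at M \<tau> R i = Some n"
        by (auto simp: run_has_output_def)
      obtain h D where "(h, D) \<in> arrivals" "config_val M D = n" "h \<le> \<tau> i" "R = collapse_run h D"
        by (rule observed_runs_with_output[OF R])
      then show "R \<in> ?F ` val_arrivals n" by (force simp: val_arrivals_def)
    qed
    show "?F ` val_arrivals n \<subseteq> ?L"
    proof clarify
      fix h D assume "(h, D) \<in> val_arrivals n"
      then have arr: "(h, D) \<in> arrivals" "config_val M D = n" by (auto simp: val_arrivals_def)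
      \<comment> \<open>Observation number \<open>h\<close> is late enough to see the arrival,
        because \<open>\<tau> h \<ge> h\<close>.\<close>
      have "\<not> \<tau> h < h" using schedule by (simp add: seq_suble not_less)
      then have "observed_output_at M \<tau> (collapse_run h D) h = Some n"
        using arr by (simp add: observed_output_at_collapse_run)
      then show "collapse_run h D \<in> observed_runs M \<tau> \<phi> \<and> run_has_output M \<tau> (collapse_run h D) (Some n)"
        using collapse_run_in_observed_runs[OF arr(1)] by (auto simp: run_has_output_def)
    qed
  qed
  have inj: "inj_on ?F (val_arrivals n)"
  proof (rule inj_onI, clarify)
    fix h D h' D'
    assume A: "(h, D) \<in> val_arrivals n" "(h', D') \<in> val_arrivals n" "collapse_run h D = collapse_run h' D'"
    \<comment> \<open>A time after both collapses, where the runs are phased kets.\<close>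
    define k where "k = Suc (max (next_obs h) (next_obs h'))"
    have "(h, D) = (h', D')"
      using A next_obs(1)[of h] next_obs(1)[of h']
      by (intro collapse_run_inj[of h D h' D' k]) (auto simp: val_arrivals_def k_def)
    then show "h = h' \<and> D = D'" by simp
  qed
  have prob: "(run_prob M \<tau> \<circ> ?F) x = arrival_prob x" if x: "x \<in> val_arrivals n" for x
  proof -
    obtain h D where hD: "x = (h, D)" by fastforce
    have "(h, D) \<in> arrivals" using x by (auto simp: hD val_arrivals_def)
    then show ?thesis using run_prob_collapse_run[of h D] by (simp add: hD)
  qed
  show ?thesis
    unfolding image
    by (rule iffD2[OF has_sum_reindex[OF inj]], rule iffD2[OF has_sum_cong[OF prob]])
      (assumption, rule has_sum_infsum[OF arrival_prob_summable])
qed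

end

theorem theorem4p3:
  fixes M :: "('a, 's) machine"
    and \<phi> :: "('a, 's) qconfig"
    and \<tau> :: "nat \<Rightarrow> nat"
    and n :: nat
  assumes "qtm M"
    and "\<phi> \<in> unit_ell2 (init_configs M)"
    and "strict_mono \<tau>"
  shows "(\<forall>i k. k = \<tau> i + 1 \<longrightarrow>
            (finite_run_prob M \<tau> has_sum value_prob M ((evolution M ^^ k) \<phi>) n)
              {rs \<in> finite_observed_runs M \<tau> \<phi> k. finite_run_output M \<tau> i rs = Some n}) \<and>
         (\<exists>p. (run_prob M \<tau> has_sum p)
                {R \<in> observed_runs M \<tau> \<phi>. run_has_output M \<tau> R (Some n)} \<and>
              (\<lambda>k. value_prob M ((evolution M ^^ k) \<phi>) n) \<longlonglongrightarrow> p)"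
proof -
  interpret qtm_computation M \<phi> \<tau> by (rule qtm_computation.intro[OF assms])
  \<comment> \<open>The witness \<open>p\<close> is the total weight of the arrivals of value
    \<open>n\<close>, at once the sum over the runs and the limit.\<close>
  show ?thesis using finite_runs_has_sum runs_has_sum value_prob_tendsto by blast
qed

end
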